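(* Let $p$ be a prime, $K=\mathbb{F}_q$ with $q=p^f$, $f\ge 1$, let $G$ be a finite abelian group of order $N$ with $p\nmid N$, and let $S\subseteq G\setminus\{0\}$ satisfy $S=-S$. Then $\mathcal{A}_{\mathbb{F}_q}(\mathrm{Cay}(G,S))$ is semisimple, and, with $\mathcal{O}$ running over the orbits of the Frobenius $\mathrm{Frob}_q:x\mapsto x^q$ on the set $\{\lambda_\chi:\chi\in\widehat{G}\}\subseteq\overline{\mathbb{F}}_q$ and $\Psi_{\mathcal{O}}$ denoting the monic minimal polynomial over $\mathbb{F}_q$ of any element of $\mathcal{O}$, the minimal polynomial of $A$ over $\mathbb{F}_q$ is $\prod_{\mathcal{O}}\Psi_{\mathcal{O}}$, a squarefree product of distinct monic irreducibles, and there is an $\mathbb{F}_q$-algebra isomorphism $$\mathcal{A}_{\mathbb{F}_q}(\mathrm{Cay}(G,S))\cong\prod_{\mathcal{O}}\mathbb{F}_q[x]/(\Psi_{\mathcal{O}}(x)).$$ Each factor is an extension $\mathbb{F}_{q^d}$ of $\mathbb{F}_q$ for some $d\ge1$.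
   Context: $G$ is written additively. $\mathrm{Cay}(G,S)$ is the graph with vertex set $G$ and edges $\{g,g+s\}$ for $g\in G$, $s\in S$; its adjacency matrix $A$, with rows and columns indexed by $G$, has $A_{g,h}=1$ if $h-g\in S$ and $0$ otherwise, regarded as a matrix over $\mathbb{F}_q$. $\mathcal{A}_{\mathbb{F}_q}(\mathrm{Cay}(G,S))=\mathbb{F}_q[A]\subseteq M_N(\mathbb{F}_q)$ is the algebra of polynomials in $A$. $\widehat{G}=\mathrm{Hom}(G,\overline{\mathbb{F}}_q^* )$ and $\lambda_\chi=\sum_{s\in S}\chi(s)$ for $\chi\in\widehat{G}$. *)

theory Defs
  imports
    "HOL-Algebra.Algebraic_Closure_Type"
    "HOL-Algebra.QuotRing"
    "HOL-Algebra.Module"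
    "HOL-Analysis.Finite_Cartesian_Product"
    "HOL-Combinatorics.Orbits"
begin

section \<open>Algebras over a field\<close>

text \<open>Algebras are \<open>Module.module\<close> records over the coefficient field
  \<^term>\<open>ring_of_type_algebra :: 'k::field ring\<close>.\<close>

definition algebra_isomorphic ::
  "'k ring \<Rightarrow> ('k, 'a) module \<Rightarrow> ('k, 'b) module \<Rightarrow> bool" where
  "algebra_isomorphic K M N \<longleftrightarrow>
     Module.algebra K M \<and> Module.algebra K N \<and>
     (\<exists>h \<in> ring_iso M N. \<forall>a \<in> carrier K. \<forall>x \<in> carrier M.
        h (a \<odot>\<^bsub>M\<^esub> x) = a \<odot>\<^bsub>N\<^esub> h x)"

definition product_algebra ::
  "'i set \<Rightarrow> ('i \<Rightarrow> ('k, 'a) module) \<Rightarrow> ('k, 'i \<Rightarrow> 'a) module" where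
  "product_algebra I M = \<lparr>
     carrier = (\<Pi>\<^sub>E i\<in>I. carrier (M i)),
     monoid.mult = (\<lambda>u v. \<lambda>i\<in>I. u i \<otimes>\<^bsub>M i\<^esub> v i),
     one = (\<lambda>i\<in>I. \<one>\<^bsub>M i\<^esub>),
     ring.zero = (\<lambda>i\<in>I. \<zero>\<^bsub>M i\<^esub>),
     add = (\<lambda>u v. \<lambda>i\<in>I. u i \<oplus>\<^bsub>M i\<^esub> v i),
     module.smult = (\<lambda>a u. \<lambda>i\<in>I. a \<odot>\<^bsub>M i\<^esub> u i) \<rparr>"

text \<open>\<open>K[x]/(\<psi>)\<close>; a scalar \<open>a\<close> acts as multiplication by the class of the
  constant polynomial \<open>a\<close>.\<close>

definition poly_quotient_algebra :: "'k::field poly \<Rightarrow> ('k, 'k poly set) module" where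
  "poly_quotient_algebra \<psi> =
     (let R = (ring_of_type_algebra :: 'k poly ring);
          I = PIdl\<^bsub>R\<^esub> \<psi>;
          Q = R Quot I
      in \<lparr> carrier = carrier Q,
           monoid.mult = monoid.mult Q,
           one = one Q,
           ring.zero = ring.zero Q,
           add = add Q,
           module.smult = (\<lambda>a C. (I +>\<^bsub>R\<^esub> [:a:]) \<otimes>\<^bsub>Q\<^esub> C) \<rparr>)"


section \<open>Semisimple rings\<close>

definition regular_module :: "('a, 'c) ring_scheme \<Rightarrow> ('a, 'a) module" where
  "regular_module R = \<lparr>
     carrier = carrier R, monoid.mult = monoid.mult R, one = one R,
     ring.zero = ring.zero R, add = add R, module.smult = monoid.mult R \<rparr>"

definition simple_submodule ::
  "('a, 'c) ring_scheme \<Rightarrow> ('a, 'b) module \<Rightarrow> 'b set \<Rightarrow> bool" where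
  "simple_submodule R M N \<longleftrightarrow>
     submodule N R M \<and> N \<noteq> {\<zero>\<^bsub>M\<^esub>} \<and>
     (\<forall>L. submodule L R M \<and> L \<subseteq> N \<longrightarrow> L = {\<zero>\<^bsub>M\<^esub>} \<or> L = N)"

text \<open>The left regular module is an internal direct sum of simple submodules.
  A finite family suffices: the unit lies in the sum of finitely many summands,
  which is then everything.\<close>

definition semisimple_ring :: "('a, 'c) ring_scheme \<Rightarrow> bool" where
  "semisimple_ring R \<longleftrightarrow>
     Ring.ring R \<and>
     (\<exists>\<N>. finite \<N> \<and> (\<forall>N\<in>\<N>. simple_submodule R (regular_module R) N) \<and>
        (\<forall>x\<in>carrier R. \<exists>!u. u \<in> (\<Pi>\<^sub>E N\<in>\<N>. N) \<and> x = (\<Oplus>\<^bsub>R\<^esub> N\<in>\<N>. u N)))"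


section \<open>Minimal polynomials\<close>

text \<open>The argument \<open>ev\<close> is evaluation of polynomials at the element whose minimal
  polynomial is meant.\<close>

definition is_min_poly :: "('k::field poly \<Rightarrow> 'b::zero) \<Rightarrow> 'k poly \<Rightarrow> bool" where
  "is_min_poly ev m \<longleftrightarrow>
     lead_coeff m = 1 \<and> ev m = 0 \<and>
     (\<forall>r. r \<noteq> 0 \<and> ev r = 0 \<longrightarrow> Polynomial.degree m \<le> Polynomial.degree r)"

definition eval_ac :: "'k::field alg_closure \<Rightarrow> 'k poly \<Rightarrow> 'k alg_closure" where
  "eval_ac x r = poly (map_poly to_ac r) x"

definition eval_matrix :: "'k::field^'n^'n \<Rightarrow> 'k poly \<Rightarrow> 'k^'n^'n" where
  "eval_matrix A r =
     (\<Sum>i\<le>Polynomial.degree r. map_matrix ((*) (poly.coeff r i)) ((((**) A) ^^ i) (mat 1)))"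

definition matrix_poly_algebra :: "'k::field^'n^'n \<Rightarrow> ('k, 'k^'n^'n) module" where
  "matrix_poly_algebra A = \<lparr>
     carrier = range (eval_matrix A),
     monoid.mult = (**),
     one = mat 1,
     ring.zero = 0,
     add = (+),
     module.smult = (\<lambda>a. map_matrix ((*) a)) \<rparr>"


section \<open>Cayley graphs and characters\<close>

definition cayley_matrix :: "'g::{ab_group_add,finite} set \<Rightarrow> (('k::field, 'g) vec, 'g) vec" where
  "cayley_matrix S = (\<chi> g h. if h - g \<in> S then 1 else 0)"

abbreviation cayley_algebra ::
  "'g::{ab_group_add,finite} set \<Rightarrow> ('k::field, (('k, 'g) vec, 'g) vec) module" where
  "cayley_algebra S \<equiv> matrix_poly_algebra (cayley_matrix S)"

definition characters :: "('g::ab_group_add \<Rightarrow> 'k::field alg_closure) set" where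
  "characters = {c. (\<forall>g. c g \<noteq> 0) \<and> (\<forall>g h. c (g + h) = c g * c h)}"

definition cayley_eigenvalues :: "'g::ab_group_add set \<Rightarrow> 'k::field alg_closure set" where
  "cayley_eigenvalues S = (\<lambda>c. \<Sum>s\<in>S. c s) ` characters"

text \<open>\<open>Orbits.orbit f x\<close> consists of the iterates \<open>f\<^sup>n x\<close> with \<open>n \<ge> 1\<close>. For a
  permutation of a finite set this is the usual orbit, and it contains \<open>x\<close>.\<close>

definition frobenius_orbits :: "nat \<Rightarrow> 'a::field set \<Rightarrow> 'a set set" where
  "frobenius_orbits q \<Lambda> = Orbits.orbit (\<lambda>x. x ^ q) ` \<Lambda>"

definition orbit_min_poly :: "'k::field alg_closure set \<Rightarrow> 'k poly" where
  "orbit_min_poly \<O> = (THE m. \<forall>x\<in>\<O>. is_min_poly (eval_ac x) m)"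

end

theory Submission
  imports
    Defs
    "HOL-Number_Theory.Residues"
begin

text \<open>
  As \<open>p\<close> does not divide \<open>N\<close>, the polynomial \<open>x\<^sup>N - 1\<close> has \<open>N\<close> distinct roots in the algebraic
  closure, so the translations of \<open>G\<close> are simultaneously diagonalisable there and the characters
  span all functions on \<open>G\<close>. A character \<open>c\<close> is an eigenvector of \<open>A\<close> with eigenvalue
  \<open>\<Sum>s\<in>S. c s\<close>; hence \<open>r(A) = 0\<close> iff \<open>r\<close> vanishes at all these eigenvalues. Since the \<open>q\<close>-th
  power of the eigenvalue of \<open>c\<close> is the eigenvalue of the character \<open>c\<^sup>q\<close>, the eigenvalues are permuted by Frobenius; the
  polynomial with root set an orbit has Frobenius-fixed coefficients and is the minimal polynomial
  of each element of the orbit. So \<open>K[A]\<close> is \<open>K[x]\<close> modulo a product of distinct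
  irreducibles, and the rest is the Chinese remainder theorem.
\<close>

section \<open>Frobenius on the algebraic closure of a finite field\<close>

text \<open>Stated for a bare function \<open>h\<close>, as it serves both for the embedding
  \<open>to_ac\<close> and for Frobenius, acting on coefficients.\<close>

lemma map_poly_hom_mult:
  fixes h :: "'a::comm_ring_1 \<Rightarrow> 'b::comm_ring_1"
  assumes "h 0 = 0" "\<And>a b. h (a + b) = h a + h b" "\<And>a b. h (a * b) = h a * h b"
  shows "map_poly h (r * s) = map_poly h r * map_poly h s"
proof -
  have "h (sum u I) = (\<Sum>i\<in>I. h (u i))" for u :: "nat \<Rightarrow> 'a" and I
    by (induction I rule: infinite_finite_induct) (auto simp: assms)
  then show ?thesis
    by (auto intro!: poly_eqI simp: coeff_map_poly coeff_mult assms)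
qed

lemma map_poly_hom_prod:
  fixes h :: "'a::comm_ring_1 \<Rightarrow> 'b::comm_ring_1"
  assumes "h 0 = 0" "h 1 = 1" "\<And>a b. h (a + b) = h a + h b" "\<And>a b. h (a * b) = h a * h b"
  shows "map_poly h (prod r I) = (\<Prod>i\<in>I. map_poly h (r i))"
  by (induction I rule: infinite_finite_induct) (auto simp: assms map_poly_hom_mult map_poly_1')

lemma map_poly_to_ac_mult: "map_poly to_ac (r * s) = map_poly to_ac r * map_poly to_ac s"
  by (rule map_poly_hom_mult) auto

lemma degree_map_poly_to_ac [simp]: "Polynomial.degree (map_poly to_ac r) = Polynomial.degree r"
  by (rule degree_map_poly) simp

lemma eval_ac_0 [simp]: "eval_ac x 0 = 0"
  by (simp add: eval_ac_def)

lemma eval_ac_pCons [simp]: "eval_ac x (pCons a r) = to_ac a + x * eval_ac x r"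
  by (simp add: eval_ac_def map_poly_pCons)

lemma eval_ac_1 [simp]: "eval_ac x 1 = 1"
  by (simp add: one_pCons)

lemma eval_ac_add [simp]: "eval_ac x (r + s) = eval_ac x r + eval_ac x s"
proof -
  have "map_poly to_ac (r + s) = map_poly to_ac r + map_poly to_ac s"
    by (auto intro!: poly_eqI simp: coeff_map_poly)
  then show ?thesis by (simp add: eval_ac_def)
qed

lemma eval_ac_mult [simp]: "eval_ac x (r * s) = eval_ac x r * eval_ac x s"
  by (simp add: eval_ac_def map_poly_to_ac_mult)

lemma eval_ac_diff [simp]: "eval_ac x (r - s) = eval_ac x r - eval_ac x s"
  using eval_ac_add[of x "r - s" s] by (simp add: algebra_simps)

lemma eval_ac_prod [simp]: "eval_ac x (prod r I) = (\<Prod>i\<in>I. eval_ac x (r i))"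
  by (induction I rule: infinite_finite_induct) auto

text \<open>Multiplication by a nonzero \<open>a\<close> permutes the nonzero elements; comparing
  their products gives \<open>a ^ (CARD('k) - 1) = 1\<close>.\<close>

lemma power_CARD_eq:
  fixes a :: "'k::field"
  assumes "finite (UNIV :: 'k set)"
  shows "a ^ CARD('k) = a"
proof (cases "a = 0")
  case True
  then show ?thesis using assms by (simp add: power_0_left)
next
  case False
  let ?U = "UNIV - {0 :: 'k}"
  have "bij_betw ((*) a) ?U ?U"
    by (rule bij_betwI[where g = "\<lambda>x. x / a"]) (use False in auto)
  then have "(\<Prod>x\<in>?U. a * x) = \<Prod>?U"
    by (rule prod.reindex_bij_betw)
  then have "a ^ card ?U * \<Prod>?U = \<Prod>?U"
    by (simp add: prod.distrib)
  moreover have "\<Prod>?U \<noteq> 0"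
    using assms by simp
  ultimately have "a ^ card ?U = 1" by simp
  moreover have "CARD('k) = Suc (card ?U)"
    using assms card.remove[of UNIV "0 :: 'k"] by simp
  ultimately show ?thesis by (metis power_Suc mult_1_right)
qed

text \<open>The elements of the base field already account for as many roots of
  \<open>x^q - x\<close> as its degree allows. This descends coefficients from the closure to the
  base field.\<close>

lemma range_to_ac_iff:
  assumes "finite (UNIV :: 'k::field set)"
  shows "x \<in> range (to_ac :: 'k \<Rightarrow> _) \<longleftrightarrow> x ^ CARD('k) = x"
proof -
  let ?q = "CARD('k)"
  define P :: "'k alg_closure poly" where "P = monom 1 ?q - monom 1 1"
  have roots: "poly P y = 0 \<longleftrightarrow> y ^ ?q = y" for y
    by (simp add: P_def poly_monom)
  \<comment> \<open>A field has at least two elements, so \<open>x^q\<close> is the leading term and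
    \<open>P\<close> is nonzero of degree q.\<close>
  have "card {0, 1 :: 'k} \<le> ?q"
    using assms by (intro card_mono) auto
  then have q: "?q > 1" by simp
  then have "Polynomial.degree (monom 1 ?q - monom (1 :: 'k alg_closure) 1) = ?q"
    by (subst diff_conv_add_uminus, subst degree_add_eq_left) (simp_all add: degree_monom_eq)
  then have deg: "Polynomial.degree P = ?q" by (simp add: P_def)
  then have P0: "P \<noteq> 0" using q by auto
  have "range to_ac = {y. poly P y = 0}"
  proof (rule card_seteq)
    show "finite {y. poly P y = 0}" using P0 by (rule poly_roots_finite)
    show "range to_ac \<subseteq> {y. poly P y = 0}"
      using power_CARD_eq[OF assms] by (auto simp: roots simp flip: to_ac_power)
    have "card (range (to_ac :: 'k \<Rightarrow> _)) = ?q" by (rule card_image) (rule inj_to_ac)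
    then show "card {y. poly P y = 0} \<le> card (range (to_ac :: 'k \<Rightarrow> _))"
      using card_poly_roots_bound[OF P0] deg by simp
  qed
  then show ?thesis using roots by auto
qed

lemma CHAR_of_prime_power_CARD:
  assumes "prime p" and "CARD('k::field) = p ^ f"
  shows "CHAR('k) = p"
proof -
  have "finite (UNIV :: 'k set)"
    by (rule card_ge_0_finite) (use assms prime_gt_0_nat in simp)
  then have "prime CHAR('k)"
    by (intro prime_CHAR_semidom finite_imp_CHAR_pos)
  moreover have "CHAR('k) dvd p ^ f"
    using CHAR_dvd_CARD[where 'a = 'k] assms by simp
  ultimately show ?thesis
    using assms(1) by (metis prime_dvd_power primes_dvd_imp_eq)
qed

lemma frobenius_add:
  fixes x y :: "'k::field alg_closure"
  assumes "prime p" and "CARD('k) = p ^ f"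
  shows "(x + y) ^ CARD('k) = x ^ CARD('k) + y ^ CARD('k)"
  using CHAR_of_prime_power_CARD[OF assms] assms
  by (intro freshmans_dream') simp_all

lemma frobenius_inj:
  assumes "prime p" and "CARD('k) = p ^ f"
  shows "inj (\<lambda>x :: 'k::field alg_closure. x ^ CARD('k))"
proof (rule injI)
  fix x y :: "'k alg_closure"
  assume "x ^ CARD('k) = y ^ CARD('k)"
  then have "(x - y) ^ CARD('k) = 0"
    using frobenius_add[OF assms, of "x - y" y] by simp
  then show "x = y" by simp
qed

text \<open>Frobenius is additive and fixes the coefficients of \<open>r\<close>. Hence the roots of
  \<open>r\<close> are closed under Frobenius.\<close>

lemma eval_ac_frobenius:
  fixes r :: "'k::field poly"
  assumes "prime p" and "CARD('k) = p ^ f"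
  shows "eval_ac (x ^ CARD('k)) r = eval_ac x r ^ CARD('k)"
proof -
  have fin: "finite (UNIV :: 'k set)"
    by (rule card_ge_0_finite) (use assms prime_gt_0_nat in simp)
  show ?thesis
  proof (induction r)
    case 0
    then show ?case using fin by (simp add: power_0_left)
  next
    case (pCons a r)
    then show ?case
      using power_CARD_eq[OF fin, of a]
      by (simp add: frobenius_add[OF assms] power_mult_distrib flip: to_ac_power)
  qed
qed

text \<open>Frobenius permutes the linear factors, so it fixes the coefficients of the product.\<close>

lemma ex_poly_of_frobenius_stable_roots:
  fixes T :: "'k::field alg_closure set"
  assumes pf: "prime p" "CARD('k) = p ^ f"
    and T: "finite T" "(\<lambda>x. x ^ CARD('k)) ` T \<subseteq> T"
  obtains m where "map_poly to_ac m = (\<Prod>t\<in>T. [:- t, 1:])"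
proof -
  let ?q = "CARD('k)" and ?P = "\<Prod>t\<in>T. [:- t, 1:]"
  let ?F = "\<lambda>x :: 'k alg_closure. x ^ ?q"
  have fin: "finite (UNIV :: 'k set)"
    by (rule card_ge_0_finite) (use pf prime_gt_0_nat in simp)
  have q0: "0 ^ ?q = (0 :: 'k alg_closure)"
    using fin by (simp add: power_0_left)
  \<comment> \<open>Obtained from additivity, so that the parity of q does not matter.\<close>
  have neg: "?F (- t) = - ?F t" for t
    using frobenius_add[OF pf, of t "- t"] q0 by (simp add: eq_neg_iff_add_eq_0 add.commute)
  have bij: "bij_betw ?F T T"
    unfolding bij_betw_def
    using endo_inj_surj[OF T] frobenius_inj[OF pf] by (meson inj_on_subset subset_UNIV)
  have "map_poly ?F ?P = (\<Prod>t\<in>T. map_poly ?F [:- t, 1:])"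
    by (rule map_poly_hom_prod) (auto simp: q0 frobenius_add[OF pf] power_mult_distrib)
  also have "\<dots> = (\<Prod>t\<in>T. [:- ?F t, 1:])"
    using q0 neg by (intro prod.cong refl) (simp add: map_poly_pCons)
  also have "\<dots> = ?P"
    by (rule prod.reindex_bij_betw[OF bij])
  finally have fixed: "map_poly ?F ?P = ?P" .
  have "?F (poly.coeff ?P i) = poly.coeff (map_poly ?F ?P) i" for i
    by (rule coeff_map_poly[where f = ?F, OF q0, symmetric])
  then have "?F (poly.coeff ?P i) = poly.coeff ?P i" for i
    by (simp only: fixed)
  then have "poly.coeff ?P i \<in> range to_ac" for i
    using range_to_ac_iff[OF fin] by blast
  then have "map_poly to_ac (map_poly of_ac ?P) = ?P"
    by (auto intro!: poly_eqI simp: coeff_map_poly to_ac_of_ac)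
  then show thesis by (rule that)
qed

section \<open>Polynomials in a matrix\<close>

abbreviation scalar_mat :: "'a::times \<Rightarrow> 'a^'n^'m \<Rightarrow> 'a^'n^'m" where
  "scalar_mat a \<equiv> map_matrix ((*) a)"

lemma scalar_mat_add: "scalar_mat (a::'a::semiring_0) (M + M') = scalar_mat a M + scalar_mat a M'"
  by (simp add: map_matrix_def vec_eq_iff distrib_left)

lemma scalar_mat_plus: "scalar_mat ((a::'a::semiring_0) + b) M = scalar_mat a M + scalar_mat b M"
  by (simp add: map_matrix_def vec_eq_iff distrib_right)

lemma scalar_mat_0 [simp]: "scalar_mat (0::'a::semiring_0) M = 0" "scalar_mat a (0 :: 'a^'n^'m) = 0"
  by (simp_all add: map_matrix_def vec_eq_iff)

lemma scalar_mat_1 [simp]: "scalar_mat (1::'a::semiring_1) M = M"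
  by (simp add: map_matrix_def vec_eq_iff)

lemma scalar_mat_mult: "scalar_mat ((a::'a::semiring_0) * b) M = scalar_mat a (scalar_mat b M)"
  by (simp add: map_matrix_def vec_eq_iff mult.assoc)

lemma scalar_mat_sum: "scalar_mat (a::'a::semiring_0) (sum M I) = (\<Sum>i\<in>I. scalar_mat a (M i))"
  by (induction I rule: infinite_finite_induct) (auto simp: scalar_mat_add)

lemma scalar_mat_mult_left: "scalar_mat (a::'a::semiring_1) M ** M' = scalar_mat a (M ** M')"
  by (simp add: map_matrix_def vec_eq_iff matrix_matrix_mult_def sum_distrib_left mult.assoc)

lemma scalar_mat_mult_right:
  "M ** scalar_mat (a::'a::comm_semiring_1) M' = scalar_mat a (M ** M')"
  by (simp add: map_matrix_def vec_eq_iff matrix_matrix_mult_def sum_distrib_left mult.left_commute)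

lemma matrix_mult_0_right [simp]: "(M :: 'a::semiring_1^'n^'m) ** (0 :: 'a^'l^'n) = 0"
  by (simp add: vec_eq_iff matrix_matrix_mult_def)

lemma matrix_mult_0_left [simp]: "(0 :: 'a::semiring_1^'n^'m) ** (M :: 'a^'l^'n) = 0"
  by (simp add: vec_eq_iff matrix_matrix_mult_def)

lemma matrix_mult_add_left: "((M :: 'a::semiring_1^'n^'m) + M') ** L = M ** L + M' ** L"
  by (simp add: vec_eq_iff matrix_matrix_mult_def distrib_right sum.distrib)

lemma matrix_mult_sum_right:
  "(M :: 'a::semiring_1^'n^'m) ** sum M' I = (\<Sum>i\<in>I. M ** M' i)"
  by (induction I rule: infinite_finite_induct) (auto simp: matrix_add_ldistrib)

text \<open>Any bound above the degree will do, so polynomials of different degrees can be summed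
  over one range.\<close>

lemma eval_matrix_altdef:
  assumes "Polynomial.degree r \<le> n"
  shows "eval_matrix A r = (\<Sum>i\<le>n. scalar_mat (poly.coeff r i) ((((**) A) ^^ i) (mat 1)))"
  unfolding eval_matrix_def
  using assms by (intro sum.mono_neutral_left) (auto simp: coeff_eq_0)

lemma eval_matrix_0 [simp]: "eval_matrix A 0 = 0"
  by (simp add: eval_matrix_def)

text \<open>Horner's rule: it makes induction over polynomials available for products and
  eigenvectors.\<close>

lemma eval_matrix_pCons:
  fixes A :: "'k::field^'n^'n"
  shows "eval_matrix A (pCons a r) = scalar_mat a (mat 1) + A ** eval_matrix A r"
proof -
  have "eval_matrix A (pCons a r) = (\<Sum>i\<le>Suc (Polynomial.degree r).
      scalar_mat (poly.coeff (pCons a r) i) ((((**) A) ^^ i) (mat 1)))"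
    by (rule eval_matrix_altdef) (simp add: degree_pCons_le)
  also have "\<dots> = scalar_mat a (mat 1) + A ** eval_matrix A r"
    by (simp only: sum.atMost_Suc_shift)
      (simp add: eval_matrix_def matrix_mult_sum_right scalar_mat_mult_right)
  finally show ?thesis .
qed

lemma eval_matrix_1 [simp]: "eval_matrix A 1 = mat 1"
  by (simp add: one_pCons eval_matrix_pCons)

lemma eval_matrix_add: "eval_matrix A (r + s) = eval_matrix A r + eval_matrix A s"
proof -
  let ?n = "max (Polynomial.degree r) (Polynomial.degree s)"
  show ?thesis
    by (simp add: eval_matrix_altdef[of _ ?n] degree_add_le scalar_mat_plus sum.distrib)
qed

lemma eval_matrix_smult: "eval_matrix A (Polynomial.smult a r) = scalar_mat a (eval_matrix A r)"
  by (simp add: eval_matrix_altdef[of _ "Polynomial.degree r"] degree_smult_le scalar_mat_sum scalar_mat_mult)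

lemma eval_matrix_mult: "eval_matrix A (r * s) = eval_matrix A r ** eval_matrix A s"
proof (induction r)
  case (pCons a r)
  have "eval_matrix A (pCons a r * s) = scalar_mat a (eval_matrix A s) + A ** eval_matrix A (r * s)"
    by (simp add: mult_pCons_left eval_matrix_add eval_matrix_smult eval_matrix_pCons)
  then show ?case
    by (simp add: pCons.IH eval_matrix_pCons matrix_mult_add_left matrix_mul_assoc scalar_mat_mult_left)
qed simp

section \<open>Matrices acting on functions with values in the algebraic closure, where the
  eigenvectors live\<close>

definition matrix_action ::
  "'k::field^'n^'n \<Rightarrow> ('n \<Rightarrow> 'k alg_closure) \<Rightarrow> 'n \<Rightarrow> 'k alg_closure" where
  "matrix_action M u g = (\<Sum>h\<in>UNIV. to_ac (M $ g $ h) * u h)"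

lemma matrix_action_add: "matrix_action (M + M') u g = matrix_action M u g + matrix_action M' u g"
  by (simp add: matrix_action_def distrib_right sum.distrib)

lemma matrix_action_scalar_mat: "matrix_action (scalar_mat a M) u g = to_ac a * matrix_action M u g"
  by (simp add: matrix_action_def map_matrix_def mult.assoc sum_distrib_left)

lemma matrix_action_mat_1: "matrix_action (mat 1) u g = u g"
  by (simp add: matrix_action_def mat_def if_distrib if_distribR cong: if_cong)

lemma matrix_action_mult: "matrix_action (M ** M') u = matrix_action M (matrix_action M' u)"
proof
  fix g
  have "matrix_action (M ** M') u g =
      (\<Sum>h\<in>UNIV. \<Sum>j\<in>UNIV. to_ac (M $ g $ j) * to_ac (M' $ j $ h) * u h)"
    by (simp add: matrix_action_def matrix_matrix_mult_def to_ac_sum sum_distrib_right)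
  also have "\<dots> = (\<Sum>j\<in>UNIV. \<Sum>h\<in>UNIV. to_ac (M $ g $ j) * to_ac (M' $ j $ h) * u h)"
    by (rule sum.swap)
  also have "\<dots> = matrix_action M (matrix_action M' u) g"
    by (simp add: matrix_action_def sum_distrib_left mult.assoc)
  finally show "matrix_action (M ** M') u g = matrix_action M (matrix_action M' u) g" .
qed

lemma matrix_action_eigenvector:
  assumes "\<And>g. matrix_action A u g = c * u g"
  shows "matrix_action (eval_matrix A r) u g = eval_ac c r * u g"
proof (induction r arbitrary: g)
  case 0
  then show ?case by (simp add: matrix_action_def)
next
  case (pCons a r)
  have "matrix_action (A ** eval_matrix A r) u g = matrix_action A (\<lambda>g. eval_ac c r * u g) g"
    using pCons.IH by (simp add: matrix_action_mult) (metis (no_types))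
  also have "\<dots> = eval_ac c r * matrix_action A u g"
    by (simp add: matrix_action_def sum_distrib_left mult.left_commute)
  finally show ?case
    by (simp add: eval_matrix_pCons matrix_action_add matrix_action_scalar_mat matrix_action_mat_1
        assms algebra_simps)
qed

text \<open>Substitute \<open>h = s + g\<close> in row \<open>g\<close> and use that
  \<open>c\<close> is multiplicative.\<close>

lemma cayley_matrix_character:
  assumes "c \<in> characters"
  shows "matrix_action (cayley_matrix S) c g = (\<Sum>s\<in>S. c s) * c g"
proof -
  have "matrix_action (cayley_matrix S) c g = (\<Sum>h\<in>UNIV. if h - g \<in> S then c h else 0)"
    by (auto simp: matrix_action_def cayley_matrix_def intro!: sum.cong)
  also have "\<dots> = (\<Sum>s\<in>UNIV. if s \<in> S then c (s + g) else 0)"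
    by (rule sum.reindex_bij_witness[of _ "\<lambda>s. s + g" "\<lambda>h. h - g"]) auto
  also have "\<dots> = (\<Sum>s\<in>S. c s * c g)"
    using assms by (auto simp: characters_def simp flip: sum.inter_filter)
  finally show ?thesis by (simp add: sum_distrib_right)
qed

section \<open>Characters\<close>

text \<open>Over an algebraically closed field the polynomial splits, and a repeated linear factor
  would produce a common root with the derivative.\<close>

lemma card_roots_separable:
  fixes r :: "'a::alg_closed_field poly"
  assumes "r \<noteq> 0" and sep: "\<And>x. poly r x = 0 \<Longrightarrow> poly (pderiv r) x \<noteq> 0"
  shows "card {x. poly r x = 0} = Polynomial.degree r"
proof -
  obtain B c where B: "size B = Polynomial.degree r"
      "r = Polynomial.smult c (\<Prod>x\<in>#B. [:- x, 1:])" and c: "c \<noteq> 0"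
    using alg_closed_imp_factorization[OF assms(1)] assms(1) by (metis leading_coeff_0_iff)
  have "poly r x = c * (\<Prod>y\<in>#B. x - y)" for x
    by (simp add: B(2) poly_prod_mset multiset.map_comp o_def)
  then have roots: "{x. poly r x = 0} = set_mset B"
    using c by (auto simp: prod_mset_zero_iff)
  have "count B x = 1" if "x \<in># B" for x
  proof (rule ccontr)
    assume "count B x \<noteq> 1"
    moreover have "count B x > 0" using that by simp
    ultimately have "count B x \<ge> 2" by linarith
    then have "{#x, x#} \<subseteq># B"
      by (auto simp: subseteq_mset_def)
    then obtain C where "B = {#x, x#} + C"
      by (auto simp: mset_subset_eq_exists_conv)
    then have s: "r = [:- x, 1:] * ([:- x, 1:] * Polynomial.smult c (\<Prod>x\<in>#C. [:- x, 1:]))"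
      by (simp only: B(2) image_mset_union image_mset_add_mset image_mset_empty prod_mset_Un
        prod_mset.add_mset prod_mset_empty mult_smult_right mult.assoc mult_1_right mult_1_left)
    have "poly r x = 0 \<and> poly (pderiv r) x = 0"
      by (simp only: s pderiv_mult) simp
    with sep show False by blast
  qed
  then have "size B = card (set_mset B)"
    by (simp add: size_multiset_overloaded_eq)
  then show ?thesis using B(1) roots by simp
qed

section \<open>Roots of unity\<close>

lemma monom_minus_1_roots:
  assumes "n > 0"
  shows "Polynomial.degree (monom 1 n - (1 :: 'a::idom poly)) = n"
    and "poly (monom 1 n - (1 :: 'a::idom poly)) z = 0 \<longleftrightarrow> z ^ n = 1"
    and "finite {z :: 'a. z ^ n = 1}" and "card {z :: 'a. z ^ n = 1} \<le> n"
proof -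
  let ?r = "monom 1 n - (1 :: 'a poly)"
  show deg: "Polynomial.degree ?r = n"
    unfolding diff_conv_add_uminus using assms
    by (subst degree_add_eq_left) (simp_all add: degree_monom_eq)
  show "poly ?r z = 0 \<longleftrightarrow> z ^ n = 1" for z
    by (simp add: poly_monom)
  then have eq: "{z. poly ?r z = 0} = {z. z ^ n = 1}" by simp
  have "?r \<noteq> 0" using deg assms by (metis degree_0 less_irrefl)
  from poly_roots_finite[OF this] card_poly_roots_bound[OF this]
  show "finite {z :: 'a. z ^ n = 1}" "card {z :: 'a. z ^ n = 1} \<le> n"
    unfolding eq deg .
qed

text \<open>The derivative \<open>n * z ^ (n - 1)\<close> does not vanish at roots of
  \<open>z ^ n - 1\<close>, because \<open>n\<close> is invertible in the field.\<close>

lemma card_roots_unity_alg_closed: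
  assumes "of_nat n \<noteq> (0 :: 'a::alg_closed_field)"
  shows "card {z :: 'a. z ^ n = 1} = n"
proof -
  have n: "n > 0" using assms by (cases n) auto
  define r where "r = monom 1 n - (1 :: 'a poly)"
  note deg = monom_minus_1_roots(1)[OF n, where 'a = 'a, folded r_def]
    and root = monom_minus_1_roots(2)[OF n, where 'a = 'a, folded r_def]
  have "poly (pderiv r) z \<noteq> 0" if "poly r z = 0" for z
    using that assms n root by (auto simp: r_def pderiv_diff pderiv_monom poly_monom power_0_left)
  moreover have "r \<noteq> 0" using deg n by auto
  ultimately show ?thesis
    using card_roots_separable[of r] deg root by simp
qed

text \<open>Orthogonality: multiplying all roots by a root \<open>w\<close> permutes them but scales
  the sum by \<open>w ^ j\<close>.\<close>

lemma sum_power_roots_unity: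
  assumes n: "of_nat n \<noteq> (0 :: 'a::alg_closed_field)" and "j < n"
  shows "(\<Sum>z | z ^ n = 1. z ^ j) = (if j = 0 then of_nat n else (0 :: 'a))"
proof (cases "j = 0")
  case True
  then show ?thesis using card_roots_unity_alg_closed[OF n] by simp
next
  case False
  let ?Z = "{z :: 'a. z ^ n = 1}"
  \<comment> \<open>There are \<open>n\<close> roots in \<open>?Z\<close> but at most
    \<open>j < n\<close> solutions of \<open>z ^ j = 1\<close>, which yields a \<open>w\<close> with
    \<open>w ^ j \<noteq> 1\<close>.\<close>
  have "\<not> ?Z \<subseteq> {z. z ^ j = 1}"
  proof
    assume sub: "?Z \<subseteq> {z. z ^ j = 1}"
    have "card ?Z \<le> card {z :: 'a. z ^ j = 1}"
      by (rule card_mono[OF _ sub]) (use False monom_minus_1_roots(3) in auto)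
    also have "\<dots> \<le> j" using False monom_minus_1_roots(4) by auto
    finally show False using card_roots_unity_alg_closed[OF n] \<open>j < n\<close> by simp
  qed
  then obtain w :: 'a where w: "w ^ n = 1" "w ^ j \<noteq> 1" by auto
  then have "w \<noteq> 0" using \<open>j < n\<close> by (auto simp: power_0_left)
  have "bij_betw ((*) w) ?Z ?Z"
    by (rule bij_betwI[where g = "\<lambda>z. z / w"])
      (use w \<open>w \<noteq> 0\<close> in \<open>auto simp: power_mult_distrib power_divide\<close>)
  then have "(\<Sum>z\<in>?Z. (w * z) ^ j) = (\<Sum>z\<in>?Z. z ^ j)"
    by (rule sum.reindex_bij_betw)
  then have "(w ^ j - 1) * (\<Sum>z\<in>?Z. z ^ j) = 0"
    by (simp add: power_mult_distrib left_diff_distrib flip: sum_distrib_left)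
  then show ?thesis using w False by simp
qed

text \<open>Lagrange's theorem for multiples of \<open>h\<close>: translation by \<open>h\<close>
  permutes the group, so the sum of all elements does not change.\<close>

lemma sum_const_CARD_eq_0:
  fixes h :: "'g::{ab_group_add,finite}"
  shows "(\<Sum>i<CARD('g). h) = 0"
proof -
  have "(\<Sum>x\<in>UNIV. x + h) = \<Sum>(UNIV :: 'g set)"
    by (rule sum.reindex_bij_witness[of _ "\<lambda>x. x - h" "\<lambda>x. x + h"]) auto
  then have *: "(\<Sum>x\<in>(UNIV :: 'g set). h) = 0"
    by (simp add: sum.distrib)
  obtain b where "bij_betw b {..<CARD('g)} (UNIV :: 'g set)"
    using ex_bij_betw_nat_finite[of "UNIV :: 'g set"] by (auto simp: atLeast0LessThan)
  from sum.reindex_bij_betw[OF this, of "\<lambda>_. h"] * show ?thesis by simp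
qed

text \<open>Up to the factor \<open>|G|\<close>, the operator \<open>u \<mapsto> P z\<close> is the projection onto the eigenspace
  of the translation by \<open>h\<close> for the eigenvalue \<open>1/z\<close>; \<open>\<Sum>i<j. h\<close> stands for \<open>j\<cdot>h\<close>.\<close>

lemma translation_eigen_decomposition:
  fixes u :: "'g::{ab_group_add,finite} \<Rightarrow> 'a::alg_closed_field" and h :: 'g
  defines "P \<equiv> \<lambda>z g. \<Sum>j<CARD('g). z ^ j * u (g + (\<Sum>i<j. h))"
  assumes n: "of_nat CARD('g) \<noteq> (0 :: 'a)"
  shows "(\<Sum>z | z ^ CARD('g) = 1. P z g) = of_nat CARD('g) * u g"
    and "z ^ CARD('g) = 1 \<Longrightarrow> z * P z (g + h) = P z g"
proof -
  let ?n = "CARD('g)"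
  have "(\<Sum>z | z ^ ?n = 1. P z g) =
      (\<Sum>j<?n. (\<Sum>z | z ^ ?n = (1 :: 'a). z ^ j) * u (g + (\<Sum>i<j. h)))"
    unfolding P_def sum_distrib_right by (rule sum.swap)
  \<comment> \<open>By orthogonality only the untranslated term survives.\<close>
  also have "\<dots> = (\<Sum>j<?n. if j = 0 then of_nat ?n * u g else 0)"
    by (intro sum.cong refl) (simp add: sum_power_roots_unity[OF n])
  also have "\<dots> = of_nat ?n * u g" by simp
  finally show "(\<Sum>z | z ^ ?n = 1. P z g) = of_nat ?n * u g" .
  assume z: "z ^ ?n = 1"
  define v where "v j = z ^ j * u (g + (\<Sum>i<j. h))" for j
  have "z * P z (g + h) = (\<Sum>j<?n. v (Suc j))"
    by (simp add: P_def v_def sum_distrib_left mult.assoc ac_simps)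
  \<comment> \<open>Shifting the index exchanges \<open>v 0\<close> for \<open>v ?n\<close>; these
    agree since \<open>z ^ ?n = 1\<close> and the \<open>?n\<close>-fold multiple of
    \<open>h\<close> is 0.\<close>
  also have "\<dots> = (\<Sum>j<?n. v j) + v ?n - v 0"
    by (simp add: sum.lessThan_Suc_shift flip: sum.lessThan_Suc)
  also have "v ?n = v 0" by (simp add: v_def z sum_const_CARD_eq_0)
  finally show "z * P z (g + h) = P z g" by (simp add: P_def v_def)
qed

text \<open>That the characters span all functions, cast as an induction rule. Assumption
  \<open>n\<close> allows division by the group order, which the averaging over roots of unity
  needs.\<close>

lemma character_span_induct [consumes 1, case_names add scale]:
  fixes P :: "('g::{ab_group_add,finite} \<Rightarrow> 'k::field alg_closure) \<Rightarrow> bool"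
  assumes n: "of_nat CARD('g) \<noteq> (0 :: 'k alg_closure)"
    and add: "\<And>u v. P u \<Longrightarrow> P v \<Longrightarrow> P (\<lambda>g. u g + v g)"
    and scale: "\<And>a c. c \<in> characters \<Longrightarrow> P (\<lambda>g. a * c g)"
  shows "P u"
proof -
  let ?n = "CARD('g)"
  have "(\<lambda>_. 1) \<in> (characters :: ('g \<Rightarrow> 'k alg_closure) set)"
    by (simp add: characters_def)
  from scale[OF this, of 0] have zero: "P (\<lambda>_. 0)" by simp
  have sum: "P (\<lambda>g. \<Sum>i\<in>I. v i g)" if "\<And>i. i \<in> I \<Longrightarrow> P (v i)"
    for I :: "'k alg_closure set" and v
    using that by (induction I rule: infinite_finite_induct) (auto intro: zero add)
  \<comment> \<open>\<open>E H\<close>: joint eigenfunctions of the translations by \<open>H\<close>. For \<open>H = UNIV\<close> these are multiples of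
    characters; an element of \<open>E H\<close> is a sum of elements of \<open>E (insert h H)\<close>.\<close>
  define E where "E H = {u :: 'g \<Rightarrow> 'k alg_closure. \<forall>h\<in>H. \<exists>c. \<forall>g. u (g + h) = c * u g}" for H
  have E_scale: "(\<lambda>g. a * w g) \<in> E H" if w: "w \<in> E H" for a w H
    unfolding E_def
  proof safe
    fix h assume "h \<in> H"
    then obtain c where "\<forall>g. w (g + h) = c * w g" using w unfolding E_def by blast
    then have "\<forall>g. a * w (g + h) = c * (a * w g)" by simp
    then show "\<exists>c. \<forall>g. a * w (g + h) = c * (a * w g)" by blast
  qed
  have top: "P u" if u: "u \<in> E UNIV" for u
  proof (cases "u 0 = 0")
    case True
    have "u g = 0" for g
    proof -
      obtain c where "\<forall>h. u (h + g) = c * u h" using u by (auto simp: E_def)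
      from this[rule_format, of 0] show ?thesis using True by simp
    qed
    then have "u = (\<lambda>_. 0)" by (rule ext)
    then show ?thesis using zero by (simp only:)
  next
    case False
    \<comment> \<open>The eigenvalue for \<open>h\<close> is read off at 0 as
      \<open>u h / u 0\<close>, so normalising \<open>u\<close> by \<open>u 0\<close> gives a
      character.\<close>
    have mult: "u (g + h) * u 0 = u h * u g" for g h
    proof -
      obtain c where "\<forall>g. u (g + h) = c * u g" using u by (auto simp: E_def)
      from this[rule_format, of g] this[rule_format, of 0] show ?thesis by simp
    qed
    have "u g \<noteq> 0" for g
      using mult[of "- g" g] False by auto
    then have "(\<lambda>g. u g / u 0) \<in> characters"
      using False mult by (simp add: characters_def field_simps)
    from scale[OF this, of "u 0"] show ?thesis using False by simp
  qed
  \<comment> \<open>The translations are removed one at a time: from \<open>E (insert h H)\<close>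
    the property passes to \<open>E H\<close>, and \<open>E {}\<close> contains every
    function.\<close>
  have down: "P u" if "\<And>u. u \<in> E H \<Longrightarrow> P u" "finite H" for H u
    using that(2,1)
  proof (induction H arbitrary: u rule: finite_induct)
    case empty
    then show ?case by (simp add: E_def)
  next
    case (insert h H)
    show ?case
    proof (rule insert.IH)
      fix u :: "'g \<Rightarrow> 'k alg_closure"
      assume u: "u \<in> E H"
      define v where "v z g = (\<Sum>j<?n. z ^ j * u (g + (\<Sum>i<j. h)))" for z g
      note dec = translation_eigen_decomposition[OF n, where u = u and h = h, folded v_def]
      have "P (\<lambda>g. \<Sum>z | z ^ ?n = 1. inverse (of_nat ?n) * v z g)"
      proof (rule sum)
        fix z :: "'k alg_closure"
        assume "z \<in> {z. z ^ ?n = 1}"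
        then have z: "z ^ ?n = 1" by simp
        then have "z \<noteq> 0" by (auto simp: power_0_left)
        \<comment> \<open>\<open>v z\<close> combines translates of \<open>u\<close>, and
          translations commute, so the eigenvalue for \<open>h'\<close> is inherited from
          \<open>u\<close>.\<close>
        have "\<exists>c. \<forall>g. v z (g + h') = c * v z g" if h': "h' \<in> H" for h'
        proof -
          obtain c where c: "\<forall>g. u (g + h') = c * u g" using u h' unfolding E_def by blast
          have "v z (g + h') = (\<Sum>j<?n. z ^ j * u (g + (\<Sum>i<j. h) + h'))" for g
            by (simp only: v_def add.assoc add.commute[of h'])
          then have "v z (g + h') = c * v z g" for g
            by (simp only: c[rule_format]) (simp add: v_def sum_distrib_left mult.left_commute)
          then show ?thesis by blast
        qed
        moreover have "v z (g + h) = inverse z * v z g" for g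
          using dec(2)[OF z, of g] \<open>z \<noteq> 0\<close> by (simp add: field_simps)
        ultimately have "v z \<in> E (insert h H)" unfolding E_def by blast
        then have "(\<lambda>g. inverse (of_nat ?n) * v z g) \<in> E (insert h H)"
          by (rule E_scale)
        then show "P (\<lambda>g. inverse (of_nat ?n) * v z g)" by (rule insert.prems)
      qed
      moreover have "(\<Sum>z | z ^ ?n = 1. inverse (of_nat ?n) * v z g) = u g" for g
        using n dec(1)[of g] by (simp flip: sum_distrib_left)
      ultimately show "P u" by simp
    qed
  qed
  show ?thesis by (rule down[OF top]) auto
qed

section \<open>The polynomials annihilating the Cayley matrix\<close>

lemma eval_cayley_matrix_eq_0_iff:
  fixes S :: "'g::{ab_group_add,finite} set" and r :: "'k::field poly"
  assumes n: "of_nat CARD('g) \<noteq> (0 :: 'k alg_closure)"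
  shows "eval_matrix (cayley_matrix S) r = 0 \<longleftrightarrow> (\<forall>x \<in> cayley_eigenvalues S. eval_ac x r = 0)"
    (is "?M = 0 \<longleftrightarrow> _")
proof
  have act: "matrix_action ?M c g = eval_ac (\<Sum>s\<in>S. c s) r * c g" if "c \<in> characters" for c g
    by (rule matrix_action_eigenvector) (rule cayley_matrix_character[OF that])
  {
    assume "?M = 0"
    \<comment> \<open>Evaluation at 0 suffices, as a character is nonzero there.\<close>
    then have "eval_ac (\<Sum>s\<in>S. c s) r = 0" if "c \<in> characters" for c
      using act[OF that, of 0] that by (auto simp: matrix_action_def characters_def)
    then show "\<forall>x \<in> cayley_eigenvalues S. eval_ac x r = 0"
      by (auto simp: cayley_eigenvalues_def)
  next
    assume ev: "\<forall>x \<in> cayley_eigenvalues S. eval_ac x r = 0"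
    have "\<forall>g. matrix_action ?M u g = 0" for u
      using n
    proof (induction u rule: character_span_induct)
      case (add u v)
      then show ?case by (simp add: matrix_action_def distrib_left sum.distrib)
    next
      case (scale a c)
      then have "matrix_action ?M c g = 0" for g
        using ev act[of c] by (auto simp: cayley_eigenvalues_def)
      moreover have "matrix_action ?M (\<lambda>g. a * c g) g = a * matrix_action ?M c g" for g
        by (simp add: matrix_action_def sum_distrib_left mult.left_commute)
      ultimately show ?case by simp
    qed
    \<comment> \<open>Acting on the indicator function of \<open>j\<close> extracts column
      \<open>j\<close>.\<close>
    from this[of "\<lambda>h. if h = j then 1 else 0" for j] have "?M $ g $ j = 0" for g j
      by (auto simp: matrix_action_def if_distrib cong: if_cong)
    then show "?M = 0" by (simp add: vec_eq_iff)
  }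
qed

text \<open>All values are roots of unity of order dividing the group order, and these form a finite
  set.\<close>

lemma finite_characters: "finite (characters :: ('g::{ab_group_add,finite} \<Rightarrow> 'k::field alg_closure) set)"
proof (rule finite_subset)
  let ?Z = "{z :: 'k alg_closure. z ^ CARD('g) = 1}"
  show "characters \<subseteq> (UNIV :: 'g set) \<rightarrow>\<^sub>E ?Z"
  proof (clarsimp simp: PiE_UNIV_domain)
    fix c :: "'g \<Rightarrow> 'k alg_closure" and g
    assume c: "c \<in> characters"
    then have one: "c 0 = 1"
      by (metis (mono_tags, lifting) add_0 characters_def mem_Collect_eq mult_cancel_right1)
    have "c (\<Sum>i<j. g) = c g ^ j" for j :: nat
      using c by (induction j) (auto simp: one characters_def mult.commute)
    from this[of "CARD('g)"] show "c g ^ CARD('g) = 1"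
      by (simp only: sum_const_CARD_eq_0 one)
  qed
  show "finite ((UNIV :: 'g set) \<rightarrow>\<^sub>E ?Z)"
    by (intro finite_PiE monom_minus_1_roots(3)) auto
qed

lemma cayley_eigenvalues_frobenius:
  fixes S :: "'g::{ab_group_add,finite} set"
  assumes "prime p" and "CARD('k::field) = p ^ f"
    and "x \<in> (cayley_eigenvalues S :: 'k alg_closure set)"
  shows "x ^ CARD('k) \<in> cayley_eigenvalues S"
proof -
  obtain c :: "'g \<Rightarrow> 'k alg_closure" where c: "c \<in> characters" "x = (\<Sum>s\<in>S. c s)"
    using assms(3) by (auto simp: cayley_eigenvalues_def)
  have q: "CARD('k) > 0" using assms prime_gt_0_nat by simp
  have "(\<lambda>g. c g ^ CARD('k)) \<in> characters"
    using c(1) by (simp add: characters_def power_mult_distrib)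
  moreover have "(\<Sum>s\<in>T. c s) ^ CARD('k) = (\<Sum>s\<in>T. c s ^ CARD('k))" for T
    by (induction T rule: infinite_finite_induct)
      (use q in \<open>auto simp: power_0_left frobenius_add[OF assms(1,2)]\<close>)
  ultimately show ?thesis
    unfolding c(2) cayley_eigenvalues_def by blast
qed

section \<open>Quotients of the polynomial ring\<close>

text \<open>An element of least degree in the ideal generated by \<open>a\<close> and
  \<open>m\<close> divides both by division with remainder, so irreducibility makes it a
  unit.\<close>

lemma irreducible_poly_bezout:
  fixes m a :: "'k::field poly"
  assumes m: "Factorial_Ring.irreducible m" and a: "\<not> m dvd a"
  obtains u v where "u * a + v * m = 1"
proof -
  define J where "J = {u * a + v * m | u v. True}"
  have closed: "s - t * d \<in> J" if "s \<in> J" "d \<in> J" for s t d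
  proof -
    from that obtain u v u' v' where "s = u * a + v * m" "d = u' * a + v' * m"
      by (auto simp: J_def)
    then have "s - t * d = (u - t * u') * a + (v - t * v') * m" by (simp add: algebra_simps)
    then show ?thesis by (auto simp: J_def)
  qed
  have "a = 1 * a + 0 * m" "m = 0 * a + 1 * m" by simp_all
  then have gen: "a \<in> J" "m \<in> J" unfolding J_def by blast+
  have "m \<noteq> 0" using m by auto
  with gen obtain d where d: "d \<in> J" "d \<noteq> 0"
      and least: "\<And>s. s \<in> J \<Longrightarrow> s \<noteq> 0 \<Longrightarrow> Polynomial.degree d \<le> Polynomial.degree s"
    using ex_has_least_nat[of "\<lambda>s. s \<in> J \<and> s \<noteq> 0" m Polynomial.degree] by blast
  have dvd: "d dvd s" if "s \<in> J" for s
  proof -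
    have "s mod d \<in> J" using closed[OF that d(1), of "s div d"] by (simp add: minus_div_mult_eq_mod)
    then have "s mod d = 0" using least degree_mod_less[OF d(2), of s] by (meson leD)
    then show ?thesis by (rule mod_0_imp_dvd)
  qed
  from dvd[OF gen(2)] obtain c where c: "m = d * c" by (rule dvdE)
  \<comment> \<open>Otherwise \<open>d\<close> would be an associate of \<open>m\<close>, and
    \<open>m\<close> would divide \<open>a\<close>.\<close>
  have "\<not> c dvd 1"
  proof
    assume "c dvd 1"
    then obtain c' where "1 = c * c'" by (rule dvdE)
    then have "d = m * c'" by (simp add: c mult.assoc)
    then have "m dvd a" using dvd[OF gen(1)] by (metis dvd_trans dvd_triv_left)
    with a show False ..
  qed
  then have "d dvd 1" using Factorial_Ring.irreducibleD[OF m c] by blast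
  then obtain d' where "1 = d * d'" by (rule dvdE)
  moreover obtain u v where "d = u * a + v * m" using d(1) by (auto simp: J_def)
  ultimately have "(d' * u) * a + (d' * v) * m = 1" by (simp add: algebra_simps)
  then show thesis by (rule that)
qed

text \<open>Euclid's lemma: multiply the Bezout identity for \<open>a\<close> and \<open>m\<close>
  by \<open>b\<close>.\<close>

lemma irreducible_poly_dvd_mult:
  fixes m :: "'k::field poly"
  assumes "Factorial_Ring.irreducible m" and "m dvd a * b" and "\<not> m dvd a"
  shows "m dvd b"
proof -
  obtain u v where "u * a + v * m = 1" using irreducible_poly_bezout assms(1,3) .
  then have "b = b * (u * a + v * m)" by simp
  also have "\<dots> = u * (a * b) + (b * v) * m" by (simp add: algebra_simps)
  finally show ?thesis using assms(2) by (metis dvd_add dvd_mult dvd_triv_right)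
qed

section \<open>The Chinese remainder theorem for pairwise non-associate irreducible
  polynomials\<close>

locale irreducible_family =
  fixes I :: "'i set" and m :: "'i \<Rightarrow> 'k::field poly"
  assumes finite: "finite I"
    and irreducible: "i \<in> I \<Longrightarrow> Factorial_Ring.irreducible (m i)"
    and not_dvd: "i \<in> I \<Longrightarrow> j \<in> I \<Longrightarrow> i \<noteq> j \<Longrightarrow> \<not> m i dvd m j"
begin

text \<open>Iterated Euclid's lemma. Together with Bezout it makes \<open>m i\<close> coprime to the
  product of the other members.\<close>

lemma not_dvd_prod:
  assumes "J \<subseteq> I" and "i \<in> I - J"
  shows "\<not> m i dvd prod m J"
proof -
  have "finite J" using assms(1) finite by (rule finite_subset)
  then show ?thesis
    using assms
  proof (induction J rule: finite_induct)
    case empty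
    then show ?case using irreducible by (auto simp: Factorial_Ring.irreducible_def)
  next
    case (insert j J)
    then show ?case
      using irreducible_poly_dvd_mult[OF irreducible, of i "m j" "prod m J"] not_dvd[of i j] by auto
  qed
qed

text \<open>The injective half of the Chinese remainder theorem: factors are split off one by one,
  each dividing the remaining cofactor.\<close>

lemma prod_dvd_iff: "prod m I dvd r \<longleftrightarrow> (\<forall>i\<in>I. m i dvd r)"
proof
  assume "prod m I dvd r"
  then show "\<forall>i\<in>I. m i dvd r" using dvd_prodI[OF finite] dvd_trans by blast
next
  assume r: "\<forall>i\<in>I. m i dvd r"
  have "finite J \<Longrightarrow> J \<subseteq> I \<Longrightarrow> prod m J dvd r" for J
  proof (induction rule: finite_induct)
    case (insert i J)
    then obtain s where s: "r = prod m J * s" by (auto elim: dvdE)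
    have "m i dvd s"
      using irreducible_poly_dvd_mult[OF irreducible, of i "prod m J" s] not_dvd_prod[of J i] insert r s
      by auto
    then show ?case using insert.hyps by (simp add: s mult.commute mult_dvd_mono)
  qed simp
  then show "prod m I dvd r" using finite by blast
qed

text \<open>The surjective half: \<open>e i\<close> is the multiple of the product of the other
  members in a Bezout identity with \<open>m i\<close>.\<close>

lemma idempotents:
  obtains e where "\<And>i. i \<in> I \<Longrightarrow> m i dvd e i - 1"
    and "\<And>i j. i \<in> I \<Longrightarrow> j \<in> I \<Longrightarrow> i \<noteq> j \<Longrightarrow> m j dvd e i"
proof -
  have "\<exists>e. m i dvd e - 1 \<and> (\<forall>j\<in>I. i \<noteq> j \<longrightarrow> m j dvd e)" if i: "i \<in> I" for i
  proof -
    have "\<not> m i dvd prod m (I - {i})" using i by (intro not_dvd_prod) auto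
    then obtain u v where uv: "u * prod m (I - {i}) + v * m i = 1"
      using irreducible_poly_bezout[OF irreducible[OF i]] by blast
    then have "u * prod m (I - {i}) - 1 = m i * (- v)" by (simp add: algebra_simps)
    moreover have "m j dvd prod m (I - {i})" if "j \<in> I" "i \<noteq> j" for j
      using that finite by (intro dvd_prodI) auto
    ultimately show ?thesis by (intro exI[of _ "u * prod m (I - {i})"]) (simp add: dvd_mult)
  qed
  then obtain e where "\<And>i. i \<in> I \<Longrightarrow> m i dvd e i - 1 \<and> (\<forall>j\<in>I. i \<noteq> j \<longrightarrow> m j dvd e i)"
    by metis
  then show thesis by (intro that[of e]) auto
qed

end

text \<open>\<open>\<phi>\<close> induces an isomorphism from \<open>K[x]/(m)\<close> onto \<open>M\<close>. The Cayley algebra, the quotient algebras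
  and their product are all handled through such surjections.\<close>

locale poly_presentation =
  fixes m :: "'k::field poly" and M :: "('k, 'b) module" and \<phi> :: "'k poly \<Rightarrow> 'b"
  assumes carrier: "carrier M = range \<phi>"
    and add: "\<phi> r \<oplus>\<^bsub>M\<^esub> \<phi> s = \<phi> (r + s)"
    and mult: "\<phi> r \<otimes>\<^bsub>M\<^esub> \<phi> s = \<phi> (r * s)"
    and zero: "\<zero>\<^bsub>M\<^esub> = \<phi> 0"
    and one: "\<one>\<^bsub>M\<^esub> = \<phi> 1"
    and smult: "a \<odot>\<^bsub>M\<^esub> \<phi> r = \<phi> (Polynomial.smult a r)"
    and ker: "\<phi> r = \<phi> 0 \<longleftrightarrow> m dvd r"
begin

lemma eq_iff: "\<phi> r = \<phi> s \<longleftrightarrow> m dvd r - s"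
proof
  assume "\<phi> r = \<phi> s"
  then have "\<phi> (r - s) = \<phi> (s - s)"
    using add[of r "- s"] add[of s "- s"] by simp
  then show "m dvd r - s" using ker by simp
next
  assume "m dvd r - s"
  then have "\<phi> (r - s) = \<phi> 0" by (simp add: ker)
  then show "\<phi> r = \<phi> s" using add[of s "r - s"] add[of s 0] by simp
qed

lemma cring: "cring M"
proof (rule cringI)
  show "abelian_group M"
  proof (rule abelian_groupI)
    fix x assume "x \<in> carrier M"
    then obtain r where "x = \<phi> r" by (auto simp: carrier)
    then have "\<phi> (- r) \<oplus>\<^bsub>M\<^esub> x = \<zero>\<^bsub>M\<^esub>" by (simp add: add zero)
    then show "\<exists>y\<in>carrier M. y \<oplus>\<^bsub>M\<^esub> x = \<zero>\<^bsub>M\<^esub>" by (auto simp: carrier)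
  qed (auto simp: carrier add zero algebra_simps)
  show "Group.comm_monoid M"
    by (rule comm_monoidI) (auto simp: carrier mult one algebra_simps)
qed (auto simp: carrier add mult algebra_simps)

lemma algebra: "Module.algebra (ring_of_type_algebra :: 'k ring) M"
proof (rule algebraI)
  show "cring (ring_of_type_algebra :: 'k ring)" by (rule cring_from_type_algebra)
qed (auto simp: cring carrier ring_of_type_algebra_def add mult smult one
      smult_add_left smult_add_right)

lemma a_inv: "\<ominus>\<^bsub>M\<^esub> \<phi> r = \<phi> (- r)"
proof -
  interpret M: cring M by (rule cring)
  show ?thesis by (rule M.minus_equality) (auto simp: carrier add zero)
qed

lemma finsum: "(\<Oplus>\<^bsub>M\<^esub>i\<in>J. \<phi> (g i)) = \<phi> (\<Sum>i\<in>J. g i)"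
proof -
  interpret M: cring M by (rule cring)
  show ?thesis
    by (induction J rule: infinite_finite_induct) (auto simp: zero carrier add)
qed

lemma isomorphic:
  assumes "poly_presentation m M' \<phi>'"
  shows "algebra_isomorphic (ring_of_type_algebra :: 'k ring) M M'"
proof -
  interpret M': poly_presentation m M' \<phi>' by fact
  \<comment> \<open>The chosen representative is irrelevant, since both presentations identify
    polynomials exactly modulo \<open>m\<close>.\<close>
  define h where "h y = \<phi>' (SOME r. \<phi> r = y)" for y
  have h: "h (\<phi> r) = \<phi>' r" for r
  proof -
    have "\<phi> (SOME s. \<phi> s = \<phi> r) = \<phi> r" by (rule someI) simp
    then show ?thesis by (simp add: h_def eq_iff M'.eq_iff)
  qed
  have "bij_betw h (carrier M) (carrier M')"
    unfolding bij_betw_def carrier M'.carrier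
    by (auto simp: inj_on_def h eq_iff M'.eq_iff image_image)
  then have "h \<in> ring_iso M M'"
    by (auto simp: ring_iso_def ring_hom_def carrier M'.carrier add mult one h M'.add M'.mult M'.one)
  moreover have "h (a \<odot>\<^bsub>M\<^esub> x) = a \<odot>\<^bsub>M'\<^esub> h x" if "x \<in> carrier M" for a x
    using that by (auto simp: carrier smult M'.smult h)
  ultimately show ?thesis
    unfolding algebra_isomorphic_def using algebra M'.algebra by blast
qed

text \<open>Bezout supplies the inverse of a class not divisible by \<open>m\<close>.\<close>

lemma field:
  assumes irr: "Factorial_Ring.irreducible m"
  shows "Ring.field M"
proof -
  interpret M: cring M by (rule cring)
  show ?thesis
  proof (rule M.cring_fieldI2)
    have "\<not> m dvd 1" using irr by (auto simp: Factorial_Ring.irreducible_def)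
    then show "\<zero>\<^bsub>M\<^esub> \<noteq> \<one>\<^bsub>M\<^esub>" by (metis ker zero one)
    fix x assume "x \<in> carrier M" "x \<noteq> \<zero>\<^bsub>M\<^esub>"
    then obtain r where r: "x = \<phi> r" "\<not> m dvd r" by (auto simp: carrier zero ker)
    obtain u v where "u * r + v * m = 1" using irreducible_poly_bezout[OF irr r(2)] .
    then have "r * u - 1 = m * (- v)" by (simp add: algebra_simps)
    then have "\<phi> r \<otimes>\<^bsub>M\<^esub> \<phi> u = \<one>\<^bsub>M\<^esub>" by (simp add: mult one eq_iff)
    then show "\<exists>y\<in>carrier M. x \<otimes>\<^bsub>M\<^esub> y = \<one>\<^bsub>M\<^esub>" using r(1) by (auto simp: carrier)
  qed
qed

text \<open>Each class contains exactly one remainder modulo \<open>m\<close>, encoded by its list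
  of \<open>degree m\<close> coefficients, padded with zeros.\<close>

lemma card_carrier:
  assumes fin: "finite (UNIV :: 'k set)" and m: "m \<noteq> 0"
  shows "card (carrier M) = CARD('k) ^ Polynomial.degree m"
proof -
  let ?d = "Polynomial.degree m"
  let ?T = "{xs :: 'k list. set xs \<subseteq> UNIV \<and> length xs = ?d}"
  \<comment> \<open>The second alternative covers \<open>?d = 0\<close>, where no degree is
    smaller.\<close>
  have deg: "Polynomial.degree (Poly xs) < ?d \<or> Poly xs = 0" if "length xs = ?d" for xs :: "'k list"
  proof (rule ccontr)
    assume "\<not> ?thesis"
    then have "lead_coeff (Poly xs) = 0" "Poly xs \<noteq> 0"
      using that by (simp_all add: nth_default_beyond)
    then show False by (simp only: leading_coeff_0_iff)
  qed
  have "bij_betw (\<lambda>xs. \<phi> (Poly xs)) ?T (carrier M)"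
    unfolding bij_betw_def
  proof safe
    show "inj_on (\<lambda>xs. \<phi> (Poly xs)) ?T"
    proof (rule inj_onI)
      fix xs ys assume xy: "xs \<in> ?T" "ys \<in> ?T" "\<phi> (Poly xs) = \<phi> (Poly ys)"
      have "Poly xs - Poly ys = 0"
      proof (rule ccontr)
        assume nz: "Poly xs - Poly ys \<noteq> 0"
        then have "?d \<le> Polynomial.degree (Poly xs - Poly ys)"
          using xy(3) by (intro dvd_imp_degree_le) (simp_all add: eq_iff)
        moreover have "Polynomial.degree (Poly xs - Poly ys) < ?d"
          using deg[of xs] deg[of ys] xy(1,2) nz by (auto intro: degree_diff_less)
        ultimately show False by simp
      qed
      then have eq: "poly.coeff (Poly xs) i = poly.coeff (Poly ys) i" for i by simp
      show "xs = ys"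
      proof (rule nth_equalityI)
        fix i assume "i < length xs"
        then show "xs ! i = ys ! i" using eq[of i] xy(1,2) by (simp add: nth_default_def)
      qed (use xy in simp)
    qed
    show "\<phi> (Poly xs) \<in> carrier M" for xs by (simp add: carrier)
    fix x assume "x \<in> carrier M"
    then obtain r where r: "x = \<phi> r" by (auto simp: carrier)
    have "m dvd r - r mod m" by (simp add: dvd_minus_mod)
    then have x: "x = \<phi> (r mod m)" by (simp add: r eq_iff)
    have "poly.coeff (r mod m) i = 0" if "i \<ge> ?d" for i
      using degree_mod_less[OF m, of r] that by (auto intro: coeff_eq_0)
    then have "r mod m = Poly (map (poly.coeff (r mod m)) [0..<?d])"
      by (intro poly_eqI) (auto simp: nth_default_def)
    then show "x \<in> (\<lambda>xs. \<phi> (Poly xs)) ` ?T"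
      using x by (intro image_eqI[of _ _ "map (poly.coeff (r mod m)) [0..<?d]"]) auto
  qed
  then have "card (carrier M) = card ?T" by (simp only: bij_betw_same_card)
  also have "\<dots> = CARD('k) ^ ?d" by (rule card_lists_length_eq[OF fin])
  finally show ?thesis .
qed

end

section \<open>Frobenius orbits and their minimal polynomials\<close>

lemma orbit_subset:
  assumes "f ` T \<subseteq> T" and "x \<in> T"
  shows "Orbits.orbit f x \<subseteq> T"
proof
  fix y assume "y \<in> Orbits.orbit f x"
  then show "y \<in> T" by induction (use assms in auto)
qed

text \<open>Iteration starts at \<open>f x\<close>, so membership of \<open>x\<close> needs proof:
  \<open>f\<close> permutes the finite orbit, some \<open>y\<close> in it has
  \<open>f y = f x\<close>, and injectivity gives \<open>y = x\<close>.\<close>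

lemma self_in_orbit_finite:
  assumes "finite T" and "f ` T \<subseteq> T" and "inj_on f T" and "x \<in> T"
  shows "x \<in> Orbits.orbit f x"
proof -
  let ?O = "Orbits.orbit f x"
  have sub: "?O \<subseteq> T" using assms by (intro orbit_subset)
  have "f ` ?O = ?O"
    using assms sub by (intro endo_inj_surj) (auto intro: orbit.intros finite_subset inj_on_subset)
  moreover have "f x \<in> ?O" by (rule orbit.intros)
  ultimately obtain y where "y \<in> ?O" "f x = f y" by (metis imageE)
  then show ?thesis using assms(3,4) sub by (metis inj_onD subsetD)
qed

lemma orbit_eq_finite:
  assumes "finite T" and "f ` T \<subseteq> T" and "inj_on f T" and "x \<in> T"
    and "y \<in> Orbits.orbit f x"
  shows "Orbits.orbit f y = Orbits.orbit f x"
  using assms(5)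
proof induction
  case base
  show ?case by (rule self_in_orbit_step) (rule self_in_orbit_finite[OF assms(1-4)])
next
  case (step y)
  then have "y \<in> T" using orbit_subset[OF assms(2,4)] by blast
  then have "Orbits.orbit f (f y) = Orbits.orbit f y"
    by (intro self_in_orbit_step self_in_orbit_finite[OF assms(1-3)])
  then show ?case using step.IH by simp
qed

section \<open>Minimal polynomials of elements of the algebraic closure\<close>

lemma is_min_poly_eval_ac_dvd_iff:
  assumes "is_min_poly (eval_ac x) m"
  shows "eval_ac x r = 0 \<longleftrightarrow> m dvd r"
proof
  assume r: "eval_ac x r = 0"
  have "eval_ac x (r mod m) = 0"
    using r assms by (simp add: is_min_poly_def minus_div_mult_eq_mod[symmetric])
  moreover have "m \<noteq> 0" using assms by (auto simp: is_min_poly_def)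
  ultimately have "r mod m = 0"
    using assms degree_mod_less[of m r] unfolding is_min_poly_def by (meson leD)
  then show "m dvd r" by (rule mod_0_imp_dvd)
next
  assume "m dvd r"
  then show "eval_ac x r = 0" using assms by (auto simp: is_min_poly_def elim!: dvdE)
qed

text \<open>Justifies the definite description in \<open>orbit_min_poly\<close>: one polynomial
  divides the other, and the quotient is a monic constant.\<close>

lemma is_min_poly_unique:
  assumes "is_min_poly (eval_ac x) m" and "is_min_poly (eval_ac x) m'"
  shows "m = m'"
proof -
  have lead: "lead_coeff m = 1" "lead_coeff m' = 1" using assms by (simp_all add: is_min_poly_def)
  then have nz: "m \<noteq> 0" "m' \<noteq> 0" by auto
  have "m dvd m'"
    using is_min_poly_eval_ac_dvd_iff[OF assms(1)] assms(2) by (simp add: is_min_poly_def)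
  then obtain a where a: "m' = m * a" by (rule dvdE)
  have "Polynomial.degree m' \<le> Polynomial.degree m"
    using assms nz by (simp add: is_min_poly_def)
  then have "Polynomial.degree a = 0"
    using a nz by (auto simp: degree_mult_eq)
  then obtain c where "a = [:c:]" by (rule degree_eq_zeroE)
  moreover have "lead_coeff a = 1" using lead a by (simp add: lead_coeff_mult)
  ultimately show ?thesis using a by simp
qed

text \<open>Evaluation lands in a field, so one factor of \<open>m\<close> vanishes at
  \<open>x\<close> and is divisible by \<open>m\<close>, which leaves a unit as the other
  factor.\<close>

lemma is_min_poly_eval_ac_irreducible:
  assumes "is_min_poly (eval_ac x) m"
  shows "Factorial_Ring.irreducible m"
proof (rule Factorial_Ring.irreducibleI)
  show "m \<noteq> 0" using assms by (auto simp: is_min_poly_def)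
  show "\<not> m dvd 1" using is_min_poly_eval_ac_dvd_iff[OF assms, of 1] by simp
  have unit: "a dvd 1" if "m = a * b" "m dvd b" for a b
  proof -
    have "b \<noteq> 0" using that \<open>m \<noteq> 0\<close> by auto
    moreover from that have "a * b dvd 1 * b" by simp
    ultimately show ?thesis by (simp only: dvd_mult_cancel_right) simp
  qed
  fix a b assume ab: "m = a * b"
  have "eval_ac x a * eval_ac x b = 0" using assms ab by (simp add: is_min_poly_def)
  then have "m dvd a \<or> m dvd b" by (simp add: is_min_poly_eval_ac_dvd_iff[OF assms])
  then show "a dvd 1 \<or> b dvd 1"
    using unit[of a b] unit[of b a] ab by (auto simp: mult.commute)
qed

text \<open>Finiteness and Frobenius stability are all that the orbit arguments use of the set of
  eigenvalues.\<close>

locale frobenius_stable =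
  fixes L :: "'k::field alg_closure set" and p f :: nat
  assumes prime: "prime p" and CARD: "CARD('k) = p ^ f"
    and finite: "finite L" and stable: "(\<lambda>x. x ^ CARD('k)) ` L \<subseteq> L"
begin

abbreviation "frob \<equiv> \<lambda>x :: 'k alg_closure. x ^ CARD('k)"
abbreviation "Orb \<equiv> frobenius_orbits CARD('k) L"

lemma CARD_pos: "CARD('k) > 0"
  using CARD prime prime_gt_0_nat by simp

lemma bij_frob: "bij_betw frob L L"
  unfolding bij_betw_def
  using endo_inj_surj[OF finite stable] inj_on_subset[OF frobenius_inj[OF prime CARD]] by auto

lemma inj_on_frob: "inj_on frob L"
  using bij_frob by (rule bij_betw_imp_inj_on)

lemma finite_Orb: "finite Orb"
  using finite by (simp add: frobenius_orbits_def)

lemma Orb_subset: "\<O> \<in> Orb \<Longrightarrow> \<O> \<subseteq> L"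
  using orbit_subset[OF stable] by (auto simp: frobenius_orbits_def)

lemma orbit_eq: "\<O> \<in> Orb \<Longrightarrow> x \<in> \<O> \<Longrightarrow> Orbits.orbit frob x = \<O>"
  using orbit_eq_finite[OF finite stable inj_on_frob] by (auto simp: frobenius_orbits_def)

lemma Orb_disjoint: "\<O> \<in> Orb \<Longrightarrow> \<O>' \<in> Orb \<Longrightarrow> x \<in> \<O> \<Longrightarrow> x \<in> \<O>' \<Longrightarrow> \<O> = \<O>'"
  using orbit_eq by blast

lemma in_Orb: "x \<in> L \<Longrightarrow> \<exists>\<O>\<in>Orb. x \<in> \<O>"
  using self_in_orbit_finite[OF finite stable inj_on_frob] by (auto simp: frobenius_orbits_def)

lemma Orb_nonempty: "\<O> \<in> Orb \<Longrightarrow> \<exists>x. x \<in> \<O>"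
  using self_in_orbit_finite[OF finite stable inj_on_frob] by (auto simp: frobenius_orbits_def)

lemma orbit_min_poly_spec:
  assumes "\<O> \<in> Orb"
  shows "map_poly to_ac (orbit_min_poly \<O>) = (\<Prod>t\<in>\<O>. [:- t, 1:])"
    and "x \<in> \<O> \<Longrightarrow> is_min_poly (eval_ac x) (orbit_min_poly \<O>)"
proof -
  have fin: "finite \<O>" using Orb_subset[OF assms] finite by (rule finite_subset)
  have orb: "frob ` \<O> \<subseteq> \<O>"
    using assms by (auto simp: frobenius_orbits_def intro: orbit.intros)
  obtain m where m: "map_poly to_ac m = (\<Prod>t\<in>\<O>. [:- t, 1:])"
    using ex_poly_of_frobenius_stable_roots[OF prime CARD fin orb] .
  have deg: "Polynomial.degree m = card \<O>"
    using arg_cong[OF m, of Polynomial.degree] by (simp add: degree_prod_eq_sum_degree)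
  have min: "is_min_poly (eval_ac x) m" if x: "x \<in> \<O>" for x
    unfolding is_min_poly_def
  proof safe
    have "to_ac (lead_coeff m) = lead_coeff (map_poly to_ac m)"
      by (simp add: coeff_map_poly)
    also have "\<dots> = to_ac 1" by (simp add: m lead_coeff_prod)
    finally show "lead_coeff m = 1" by (simp only: to_ac_eq_iff)
    show "eval_ac x m = 0" using x fin by (auto simp: eval_ac_def m poly_prod)
    fix r assume r: "eval_ac x r = 0" "r \<noteq> 0"
    \<comment> \<open>A root at \<open>x\<close> propagates along the orbit, so \<open>r\<close> has
      at least \<open>card \<O>\<close> roots.\<close>
    have "eval_ac y r = 0" if "y \<in> Orbits.orbit frob x" for y
      using that
      by induction (use CARD_pos in \<open>simp_all add: eval_ac_frobenius[OF prime CARD] r power_0_left\<close>)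
    then have sub: "\<O> \<subseteq> {y. poly (map_poly to_ac r) y = 0}"
      using orbit_eq[OF assms x] by (auto simp: eval_ac_def)
    have r': "map_poly to_ac r \<noteq> 0" using r(2) by (simp add: map_poly_eq_0_iff)
    have "card \<O> \<le> card {y. poly (map_poly to_ac r) y = 0}"
      by (rule card_mono[OF poly_roots_finite[OF r'] sub])
    also have "\<dots> \<le> Polynomial.degree r"
      using card_poly_roots_bound[OF r'] by simp
    finally show "Polynomial.degree m \<le> Polynomial.degree r" by (simp add: deg)
  qed
  \<comment> \<open>On an empty set the description of \<open>orbit_min_poly\<close> would determine
    nothing.\<close>
  obtain y where "y \<in> \<O>" using Orb_nonempty[OF assms] by blast
  then have "orbit_min_poly \<O> = m"
    unfolding orbit_min_poly_def using min is_min_poly_unique by (intro the_equality) blast+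
  then show "map_poly to_ac (orbit_min_poly \<O>) = (\<Prod>t\<in>\<O>. [:- t, 1:])"
    and "x \<in> \<O> \<Longrightarrow> is_min_poly (eval_ac x) (orbit_min_poly \<O>)"
    using m min by simp_all
qed

lemma eval_ac_orbit_min_poly_eq_0_iff:
  assumes "\<O> \<in> Orb"
  shows "eval_ac x (orbit_min_poly \<O>) = 0 \<longleftrightarrow> x \<in> \<O>"
  using orbit_min_poly_spec(1)[OF assms] finite_subset[OF Orb_subset[OF assms] finite]
  by (simp add: eval_ac_def poly_prod)

lemma orbit_min_poly_dvd_iff:
  "\<O> \<in> Orb \<Longrightarrow> x \<in> \<O> \<Longrightarrow> orbit_min_poly \<O> dvd r \<longleftrightarrow> eval_ac x r = 0"
  using orbit_min_poly_spec(2) is_min_poly_eval_ac_dvd_iff by blast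

lemma orbit_min_poly_monic: "\<O> \<in> Orb \<Longrightarrow> lead_coeff (orbit_min_poly \<O>) = 1"
  using Orb_nonempty orbit_min_poly_spec(2) by (metis is_min_poly_def)

lemma orbit_min_poly_irreducible:
  "\<O> \<in> Orb \<Longrightarrow> Factorial_Ring.irreducible (orbit_min_poly \<O>)"
  using Orb_nonempty orbit_min_poly_spec(2) is_min_poly_eval_ac_irreducible by metis

text \<open>The roots of \<open>orbit_min_poly \<O>\<close> are exactly \<open>\<O>\<close>, and
  distinct orbits are disjoint.\<close>

sublocale fam: irreducible_family Orb orbit_min_poly
proof
  fix \<O> \<O>' assume *: "\<O> \<in> Orb" "\<O>' \<in> Orb" "\<O> \<noteq> \<O>'"
  obtain x where "x \<in> \<O>" using Orb_nonempty[OF *(1)] by blast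
  with * show "\<not> orbit_min_poly \<O> dvd orbit_min_poly \<O>'"
    using Orb_disjoint by (auto simp: orbit_min_poly_dvd_iff eval_ac_orbit_min_poly_eq_0_iff)
qed (simp_all add: finite_Orb orbit_min_poly_irreducible)

lemma inj_on_orbit_min_poly: "inj_on orbit_min_poly Orb"
  by (rule inj_onI) (metis fam.not_dvd dvd_refl)

lemma eval_ac_eq_0_iff_prod_dvd:
  "(\<forall>x\<in>L. eval_ac x r = 0) \<longleftrightarrow> (\<Prod>\<O>\<in>Orb. orbit_min_poly \<O>) dvd r"
  unfolding fam.prod_dvd_iff
  using in_Orb Orb_subset Orb_nonempty orbit_min_poly_dvd_iff by (metis subsetD)

text \<open>A non-unit \<open>s\<close> has a root in the closure. If its square divides the
  product, the root lies in some orbit, whose minimal polynomial then divides the product twice and,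
  after cancelling, the product of the others.\<close>

lemma squarefree_prod_orbit_min_poly: "squarefree (\<Prod>\<O>\<in>Orb. orbit_min_poly \<O>)"
proof (rule squarefreeI)
  fix s assume s: "s\<^sup>2 dvd (\<Prod>\<O>\<in>Orb. orbit_min_poly \<O>)"
  show "s dvd 1"
  proof (rule ccontr)
    assume "\<not> s dvd 1"
    moreover have "(\<Prod>\<O>\<in>Orb. orbit_min_poly \<O>) \<noteq> 0"
      using finite_Orb orbit_min_poly_irreducible by (auto simp: Factorial_Ring.irreducible_def)
    then have "s \<noteq> 0" using s by auto
    ultimately have "Polynomial.degree (map_poly to_ac s) > 0"
      by (simp add: is_unit_iff_degree)
    then obtain x where x: "eval_ac x s = 0"
      unfolding eval_ac_def using alg_closed_imp_poly_has_root by blast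
    then have "eval_ac x (\<Prod>\<O>\<in>Orb. orbit_min_poly \<O>) = 0"
      using s by (auto simp: power2_eq_square elim!: dvdE simp del: eval_ac_prod)
    then obtain \<O> where O: "\<O> \<in> Orb" "x \<in> \<O>"
      using finite_Orb by (auto simp: eval_ac_orbit_min_poly_eq_0_iff)
    let ?m = "orbit_min_poly \<O>"
    have "?m dvd s" using O x by (simp add: orbit_min_poly_dvd_iff)
    then have "?m * ?m dvd (\<Prod>\<O>\<in>Orb. orbit_min_poly \<O>)"
      using s unfolding power2_eq_square by (meson dvd_trans mult_dvd_mono)
    also have "\<dots> = ?m * (\<Prod>\<O>\<in>Orb - {\<O>}. orbit_min_poly \<O>)"
      using finite_Orb O(1) by (rule prod.remove)
    finally have "?m dvd (\<Prod>\<O>\<in>Orb - {\<O>}. orbit_min_poly \<O>)"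
      using orbit_min_poly_monic[OF O(1)] by (subst (asm) dvd_mult_cancel_left) auto
    then show False using fam.not_dvd_prod[of "Orb - {\<O>}" \<O>] O(1) by blast
  qed
qed

end

section \<open>The algebras of the theorem\<close>

lemma poly_presentation_quotient:
  fixes m :: "'k::field poly"
  shows "poly_presentation m (poly_quotient_algebra m)
    (\<lambda>r. PIdl\<^bsub>ring_of_type_algebra\<^esub> m +>\<^bsub>ring_of_type_algebra\<^esub> r)"
proof -
  define R where "R = (ring_of_type_algebra :: 'k poly ring)"
  define I where "I = PIdl\<^bsub>R\<^esub> m"
  have R [simp]: "carrier R = UNIV" "r \<otimes>\<^bsub>R\<^esub> s = r * s" "r \<oplus>\<^bsub>R\<^esub> s = r + s"
    "\<one>\<^bsub>R\<^esub> = 1" "\<zero>\<^bsub>R\<^esub> = 0" for r s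
    by (simp_all add: R_def ring_of_type_algebra_def)
  interpret R: cring R unfolding R_def by (rule cring_from_type_algebra)
  interpret I: ideal I R unfolding I_def by (rule R.cgenideal_ideal) simp
  have zero [simp]: "I +>\<^bsub>R\<^esub> 0 = I" by (simp add: a_r_coset_def')
  have "r \<in> I \<longleftrightarrow> m dvd r" for r
    by (auto simp: I_def cgenideal_def dvd_def mult.commute)
  moreover have "I +>\<^bsub>R\<^esub> r = I \<longleftrightarrow> r \<in> I" for r
    by (metis I.a_rcos_const I.a_rcos_self R(1) UNIV_I)
  ultimately have "poly_presentation m (poly_quotient_algebra m) (\<lambda>r. I +>\<^bsub>R\<^esub> r)"
    by unfold_locales
      (auto simp: poly_quotient_algebra_def Let_def FactRing_def A_RCOSETS_def' I.rcoset_mult_add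
        I.a_rcos_sum simp flip: R_def I_def)
  then show ?thesis by (simp only: R_def I_def)
qed

lemma (in irreducible_family) poly_presentation_product:
  assumes pres: "\<And>i. i \<in> I \<Longrightarrow> poly_presentation (m i) (M i) (\<phi> i)"
  shows "poly_presentation (prod m I) (product_algebra I M) (\<lambda>r. \<lambda>i\<in>I. \<phi> i r)"
proof -
  obtain e where e: "\<And>i. i \<in> I \<Longrightarrow> m i dvd e i - 1"
      "\<And>i j. i \<in> I \<Longrightarrow> j \<in> I \<Longrightarrow> i \<noteq> j \<Longrightarrow> m j dvd e i"
    using idempotents by blast
  have "y \<in> range (\<lambda>r. \<lambda>i\<in>I. \<phi> i r)" if y: "y \<in> (\<Pi>\<^sub>E i\<in>I. carrier (M i))" for y
  proof -
    have "\<forall>i\<in>I. \<exists>r. y i = \<phi> i r"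
      using PiE_mem[OF y] by (auto simp: poly_presentation.carrier[OF pres])
    then obtain r where r: "\<And>i. i \<in> I \<Longrightarrow> y i = \<phi> i (r i)" by metis
    \<comment> \<open>Modulo \<open>m i\<close> only the summand \<open>j = i\<close> survives, and
      \<open>e i\<close> is congruent to 1.\<close>
    have eq: "\<phi> i (r i) = \<phi> i (\<Sum>j\<in>I. e j * r j)" if i: "i \<in> I" for i
    proof -
      have "r i - (\<Sum>j\<in>I. e j * r j) = - ((e i - 1) * r i + (\<Sum>j\<in>I - {i}. e j * r j))"
        using i finite by (simp add: sum.remove algebra_simps)
      moreover have "m i dvd (e i - 1) * r i + (\<Sum>j\<in>I - {i}. e j * r j)"
        using i e by (intro dvd_add dvd_sum dvd_mult2) auto
      ultimately have "m i dvd r i - (\<Sum>j\<in>I. e j * r j)" by (simp only: dvd_minus_iff)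
      then show ?thesis by (simp add: poly_presentation.eq_iff[OF pres[OF i]])
    qed
    have "y = (\<lambda>i\<in>I. \<phi> i (\<Sum>j\<in>I. e j * r j))"
      by (rule extensionalityI[of _ I]) (use y in \<open>simp_all add: PiE_iff r eq\<close>)
    then show ?thesis by blast
  qed
  moreover have "(\<lambda>i\<in>I. \<phi> i r) \<in> (\<Pi>\<^sub>E i\<in>I. carrier (M i))" for r
    by (auto simp: poly_presentation.carrier[OF pres])
  ultimately have "(\<Pi>\<^sub>E i\<in>I. carrier (M i)) = range (\<lambda>r. \<lambda>i\<in>I. \<phi> i r)" by blast
  moreover have "(\<lambda>i\<in>I. \<phi> i r) = (\<lambda>i\<in>I. \<phi> i 0) \<longleftrightarrow> prod m I dvd r" for r
    by (auto simp: prod_dvd_iff restrict_def fun_eq_iff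
        poly_presentation.ker[OF pres])
  ultimately show ?thesis
    by unfold_locales
      (auto simp: product_algebra_def poly_presentation.add[OF pres] poly_presentation.mult[OF pres]
        poly_presentation.zero[OF pres] poly_presentation.one[OF pres]
        poly_presentation.smult[OF pres] cong: restrict_cong)
qed

lemma poly_presentation_cayley:
  fixes S :: "'g::{ab_group_add,finite} set" and m :: "'k::field poly"
  assumes "\<And>r. eval_matrix (cayley_matrix S) r = 0 \<longleftrightarrow> m dvd r"
  shows "poly_presentation m (cayley_algebra S) (eval_matrix (cayley_matrix S))"
  by unfold_locales
    (simp_all add: matrix_poly_algebra_def eval_matrix_add eval_matrix_mult eval_matrix_smult assms)

text \<open>The orthogonal idempotents \<open>\<phi> (e i)\<close> split the ring into the minimal
  ideals that they generate.\<close>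

lemma (in irreducible_family) semisimple:
  assumes "poly_presentation (prod m I) M \<phi>"
  shows "semisimple_ring M"
proof -
  interpret M: poly_presentation "prod m I" M \<phi> by fact
  interpret M': cring M by (rule M.cring)
  obtain e where e: "\<And>i. i \<in> I \<Longrightarrow> m i dvd e i - 1"
      "\<And>i j. i \<in> I \<Longrightarrow> j \<in> I \<Longrightarrow> i \<noteq> j \<Longrightarrow> m j dvd e i"
    using idempotents by blast
  \<comment> \<open>For \<open>i\<close> in \<open>I\<close> these are the multiples of the product
    of the other members; the images \<open>N i\<close> are the simple summands.\<close>
  define T where "T i = {s. \<forall>j\<in>I. i \<noteq> j \<longrightarrow> m j dvd s}" for i
  define N where "N i = \<phi> ` T i" for i
  have T_I: "e i \<in> T i" if "i \<in> I" for i
    using e(2) that by (simp add: T_def)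
  have prod_dvd: "prod m I dvd s" if "s \<in> T i" "m i dvd s" for s i
    unfolding prod_dvd_iff
  proof
    fix j assume "j \<in> I"
    then show "m j dvd s" using that by (cases "i = j") (auto simp: T_def)
  qed
  have not_dvd_e: "\<not> m i dvd e i" if "i \<in> I" for i
  proof
    assume "m i dvd e i"
    then have "m i dvd e i - (e i - 1)" using e(1)[OF that] by (rule dvd_diff)
    then show False using irreducible[OF that] by (simp add: Factorial_Ring.irreducible_def)
  qed
  have sub_iff: "submodule L M (regular_module M) \<longleftrightarrow> L \<subseteq> carrier M \<and> \<zero>\<^bsub>M\<^esub> \<in> L \<and>
      (\<forall>x\<in>L. \<forall>y\<in>L. x \<oplus>\<^bsub>M\<^esub> y \<in> L) \<and> (\<forall>x\<in>L. \<ominus>\<^bsub>M\<^esub> x \<in> L) \<and>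
      (\<forall>a\<in>carrier M. \<forall>x\<in>L. a \<otimes>\<^bsub>M\<^esub> x \<in> L)" for L
    by (auto simp: submodule_def submodule_axioms_def subgroup_def regular_module_def
        a_inv_def m_inv_def)
  have N_submodule: "submodule (N i) M (regular_module M)" for i
    by (auto simp: sub_iff N_def T_def M.carrier M.zero M.add M.a_inv M.mult)
  have simple: "simple_submodule M (regular_module M) (N i)" if i: "i \<in> I" for i
    unfolding simple_submodule_def
  proof (intro conjI allI impI)
    have zero: "\<zero>\<^bsub>regular_module M\<^esub> = \<phi> 0" by (simp add: regular_module_def M.zero)
    show "submodule (N i) M (regular_module M)" by (rule N_submodule)
    have "\<phi> (e i) \<noteq> \<phi> 0"
      using not_dvd_e[OF i] i by (auto simp: M.ker prod_dvd_iff)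
    moreover have "\<phi> (e i) \<in> N i" using T_I[OF i] by (simp add: N_def)
    ultimately show "N i \<noteq> {\<zero>\<^bsub>regular_module M\<^esub>}" unfolding zero by blast
    fix L assume "submodule L M (regular_module M) \<and> L \<subseteq> N i"
    then have L: "\<zero>\<^bsub>M\<^esub> \<in> L" "L \<subseteq> N i"
        and L_mult: "\<And>a x. a \<in> carrier M \<Longrightarrow> x \<in> L \<Longrightarrow> a \<otimes>\<^bsub>M\<^esub> x \<in> L"
      by (auto simp: sub_iff)
    have "\<phi> 0 \<in> L" using L(1) by (simp add: M.zero)
    show "L = {\<zero>\<^bsub>regular_module M\<^esub>} \<or> L = N i"
    proof (cases "L = {\<phi> 0}")
      case False
      then obtain x where "x \<in> L" "x \<noteq> \<phi> 0" using \<open>\<phi> 0 \<in> L\<close> by blast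
      then obtain r where r: "r \<in> T i" "\<phi> r \<in> L" "\<phi> r \<noteq> \<phi> 0" using L(2) by (auto simp: N_def)
      then have "\<not> m i dvd r" using prod_dvd by (auto simp: M.ker)
      then obtain u v where uv: "u * r + v * m i = 1"
        using irreducible_poly_bezout[OF irreducible[OF i]] by blast
      \<comment> \<open>A nonzero \<open>\<phi> r\<close> in \<open>L\<close> generates
        \<open>N i\<close>: \<open>r\<close> has inverse \<open>u\<close> modulo \<open>m i\<close>,
        and \<open>s\<close> is already divisible by the other members, so \<open>s\<close> and
        \<open>s * u * r\<close> agree modulo the product.\<close>
      have "\<phi> s \<in> L" if s: "s \<in> T i" for s
      proof -
        have "s - s * u * r = s * v * m i"
          using arg_cong[OF uv, of "\<lambda>t. s * t"] by (simp add: algebra_simps)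
        moreover have "prod m I dvd s * v * m i"
          using s by (intro prod_dvd[of _ i]) (simp_all add: T_def)
        ultimately have "\<phi> s = \<phi> (s * u) \<otimes>\<^bsub>M\<^esub> \<phi> r"
          by (simp add: M.mult M.eq_iff)
        then show ?thesis using L_mult r(2) by (simp add: M.carrier)
      qed
      then have "N i \<subseteq> L" by (auto simp: N_def)
      with L(2) show ?thesis by blast
    qed (simp add: zero)
  qed
  have inj: "inj_on N I"
  proof (rule inj_onI, rule ccontr)
    fix i j assume ij: "i \<in> I" "j \<in> I" "N i = N j" "i \<noteq> j"
    then obtain s where s: "s \<in> T j" "\<phi> (e i) = \<phi> s" using T_I[of i] by (auto simp: N_def)
    then have "m i dvd e i - s" "m i dvd s" using ij by (auto simp: M.eq_iff prod_dvd_iff T_def)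
    then have "m i dvd e i - s + s" by (rule dvd_add)
    then show False using not_dvd_e[OF ij(1)] by simp
  qed
  have "\<exists>!u. u \<in> (\<Pi>\<^sub>E Y\<in>N ` I. Y) \<and> \<phi> r = (\<Oplus>\<^bsub>M\<^esub>Y\<in>N ` I. u Y)" for r
  proof -
    \<comment> \<open>The component in \<open>N i\<close> is the projection \<open>r * e i\<close>;
      \<open>inv_into\<close> recovers the index.\<close>
    define u where "u = (\<lambda>Y\<in>N ` I. \<phi> (r * e (inv_into I N Y)))"
    have u: "u (N i) = \<phi> (r * e i)" if "i \<in> I" for i
      using that inj by (simp add: u_def)
    have finsum_N: "(\<Oplus>\<^bsub>M\<^esub>Y\<in>N ` I. v Y) = \<phi> (\<Sum>i\<in>I. g i)"
      if v: "\<And>i. i \<in> I \<Longrightarrow> v (N i) = \<phi> (g i)" for v g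
    proof -
      have "(\<Oplus>\<^bsub>M\<^esub>Y\<in>N ` I. v Y) = (\<Oplus>\<^bsub>M\<^esub>i\<in>I. v (N i))"
        by (rule M'.finsum_reindex) (auto simp: v M.carrier inj)
      also have "\<dots> = (\<Oplus>\<^bsub>M\<^esub>i\<in>I. \<phi> (g i))"
        by (rule M'.finsum_cong') (auto simp: v M.carrier)
      finally show ?thesis by (simp add: M.finsum)
    qed
    show ?thesis
    proof (rule ex1I[of _ u], intro conjI)
      show "u \<in> (\<Pi>\<^sub>E Y\<in>N ` I. Y)"
      proof (rule PiE_I)
        fix Y assume "Y \<in> N ` I"
        then obtain i where i: "i \<in> I" "Y = N i" by blast
        then have "r * e i \<in> T i" using T_I by (simp add: T_def)
        then show "u Y \<in> Y" using i u by (auto simp: N_def)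
      qed (auto simp: u_def)
      have "m i dvd r - (\<Sum>j\<in>I. r * e j)" if i: "i \<in> I" for i
      proof -
        have "r - (\<Sum>j\<in>I. r * e j) = - (r * (e i - 1) + (\<Sum>j\<in>I - {i}. r * e j))"
          using i finite by (simp add: sum.remove algebra_simps)
        moreover have "m i dvd r * (e i - 1) + (\<Sum>j\<in>I - {i}. r * e j)"
          using i e by (intro dvd_add dvd_sum dvd_mult) auto
        ultimately show ?thesis by (simp only: dvd_minus_iff)
      qed
      then show "\<phi> r = (\<Oplus>\<^bsub>M\<^esub>Y\<in>N ` I. u Y)"
        by (simp add: finsum_N[of u "\<lambda>i. r * e i", OF u] M.eq_iff prod_dvd_iff)
    next
      fix v assume v: "v \<in> (\<Pi>\<^sub>E Y\<in>N ` I. Y) \<and> \<phi> r = (\<Oplus>\<^bsub>M\<^esub>Y\<in>N ` I. v Y)"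
      have "\<forall>i\<in>I. \<exists>s\<in>T i. v (N i) = \<phi> s"
      proof
        fix i assume "i \<in> I"
        then have "v (N i) \<in> N i" using v by (auto dest: PiE_mem)
        then show "\<exists>s\<in>T i. v (N i) = \<phi> s" by (auto simp: N_def)
      qed
      then obtain g where g: "\<And>i. i \<in> I \<Longrightarrow> g i \<in> T i" "\<And>i. i \<in> I \<Longrightarrow> v (N i) = \<phi> (g i)"
        by metis
      have r: "prod m I dvd (\<Sum>j\<in>I. g j) - r"
        using v finsum_N[of v g, OF g(2)] by (simp add: M.eq_iff dvd_diff_commute)
      have eq: "v (N i) = u (N i)" if i: "i \<in> I" for i
      proof -
        \<comment> \<open>Multiplication by \<open>e i\<close> kills the other components and fixes
          \<open>g i\<close>, which forces \<open>g i\<close> to agree with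
          \<open>r * e i\<close>.\<close>
        have "prod m I dvd (\<Sum>j\<in>I - {i}. g j * e i) + g i * (e i - 1)"
        proof (intro dvd_add dvd_sum)
          fix j assume "j \<in> I - {i}"
          then show "prod m I dvd g j * e i"
            using g(1)[of j] e(2)[OF i, of j] by (intro prod_dvd[of _ j]) (auto simp: T_def)
        next
          show "prod m I dvd g i * (e i - 1)"
            using g(1)[OF i] e(1)[OF i] by (intro prod_dvd[of _ i]) (auto simp: T_def)
        qed
        also have "(\<Sum>j\<in>I - {i}. g j * e i) + g i * (e i - 1) = (\<Sum>j\<in>I. g j * e i) - g i"
          using i finite by (simp add: sum.remove algebra_simps)
        finally have "prod m I dvd (\<Sum>j\<in>I. g j) * e i - g i" by (simp add: sum_distrib_right)
        moreover have "prod m I dvd ((\<Sum>j\<in>I. g j) - r) * e i" using r by (rule dvd_mult2)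
        ultimately have "prod m I dvd ((\<Sum>j\<in>I. g j) * e i - g i) - ((\<Sum>j\<in>I. g j) - r) * e i"
          by (rule dvd_diff)
        then have "prod m I dvd r * e i - g i" by (simp add: algebra_simps)
        then show ?thesis by (simp add: u[OF i] g(2)[OF i] M.eq_iff dvd_diff_commute)
      qed
      show "v = u"
        by (rule extensionalityI[of _ "N ` I"]) (use v eq in \<open>auto simp: PiE_iff u_def\<close>)
    qed
  qed
  then have "\<forall>x\<in>carrier M. \<exists>!u. u \<in> (\<Pi>\<^sub>E Y\<in>N ` I. Y) \<and> x = (\<Oplus>\<^bsub>M\<^esub>Y\<in>N ` I. u Y)"
    by (simp add: M.carrier)
  moreover have "\<forall>Y\<in>N ` I. simple_submodule M (regular_module M) Y"
    using simple by blast
  ultimately show ?thesis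
    unfolding semisimple_ring_def using finite M'.ring_axioms by blast
qed

theorem proposition14p1:
  fixes p f q N :: nat
    and S :: "'g::{ab_group_add,finite} set"
  assumes "prime p" and "f \<ge> 1" and "q = p ^ f"
    and "CARD('k::field) = q"
    and "CARD('g) = N" and "\<not> p dvd N"
    and "0 \<notin> S" and "S = uminus ` S"
  shows
    "let K = (ring_of_type_algebra :: 'k ring);
         A = (cayley_matrix S :: (('k, 'g) vec, 'g) vec);
         \<Lambda> = (cayley_eigenvalues S :: 'k alg_closure set);
         \<Omega> = frobenius_orbits q \<Lambda>;
         \<Psi> = (orbit_min_poly :: 'k alg_closure set \<Rightarrow> 'k poly)
     in semisimple_ring (cayley_algebra S :: ('k, (('k, 'g) vec, 'g) vec) module) \<and>
        bij_betw (\<lambda>x. x ^ q) \<Lambda> \<Lambda> \<and>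
        (\<forall>\<O>\<in>\<Omega>. \<forall>x\<in>\<O>. is_min_poly (eval_ac x) (\<Psi> \<O>)) \<and>
        is_min_poly (eval_matrix A) (\<Prod>\<O>\<in>\<Omega>. \<Psi> \<O>) \<and>
        squarefree (\<Prod>\<O>\<in>\<Omega>. \<Psi> \<O>) \<and>
        inj_on \<Psi> \<Omega> \<and>
        (\<forall>\<O>\<in>\<Omega>. lead_coeff (\<Psi> \<O>) = 1 \<and> Factorial_Ring.irreducible (\<Psi> \<O>)) \<and>
        algebra_isomorphic K (cayley_algebra S :: ('k, (('k, 'g) vec, 'g) vec) module)
          (product_algebra \<Omega> (\<lambda>\<O>. poly_quotient_algebra (\<Psi> \<O>))) \<and>
        (\<forall>\<O>\<in>\<Omega>. Ring.field (poly_quotient_algebra (\<Psi> \<O>)) \<and>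
             Module.algebra K (poly_quotient_algebra (\<Psi> \<O>)) \<and>
             (\<exists>d\<ge>1. card (carrier (poly_quotient_algebra (\<Psi> \<O>))) = q ^ d))"
proof -
  let ?A = "cayley_matrix S :: (('k, 'g) vec, 'g) vec"
  let ?L = "cayley_eigenvalues S :: 'k alg_closure set"
  have CARD: "CARD('k) = p ^ f" using assms(3,4) by simp
  interpret frobenius_stable ?L p f
    using assms(1) CARD cayley_eigenvalues_frobenius[OF assms(1) CARD, of _ S]
    by unfold_locales (auto simp: cayley_eigenvalues_def finite_characters)
  let ?m = "\<Prod>\<O>\<in>Orb. orbit_min_poly \<O>"
  \<comment> \<open>The hypothesis that \<open>p\<close> does not divide \<open>N\<close> enters
    here, \<open>p\<close> being the characteristic.\<close>
  have n: "of_nat CARD('g) \<noteq> (0 :: 'k alg_closure)"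
    using assms(5,6) CHAR_of_prime_power_CARD[OF assms(1) CARD]
    by (simp add: of_nat_eq_0_iff_char_dvd)
  have ker: "eval_matrix ?A r = 0 \<longleftrightarrow> ?m dvd r" for r
    by (simp only: eval_cayley_matrix_eq_0_iff[OF n] eval_ac_eq_0_iff_prod_dvd)
  interpret cayley: poly_presentation ?m "cayley_algebra S" "eval_matrix ?A"
    by (rule poly_presentation_cayley) (rule ker)
  have quot: "poly_presentation (orbit_min_poly \<O>) (poly_quotient_algebra (orbit_min_poly \<O>))
      (\<lambda>r. PIdl\<^bsub>ring_of_type_algebra\<^esub> (orbit_min_poly \<O>) +>\<^bsub>ring_of_type_algebra\<^esub> r)"
    for \<O> :: "'k alg_closure set"
    by (rule poly_presentation_quotient)
  have monic: "lead_coeff ?m = 1"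
    by (simp add: lead_coeff_prod orbit_min_poly_monic)
  then have "?m \<noteq> 0" by auto
  then have min: "is_min_poly (eval_matrix ?A) ?m"
    using monic ker by (auto simp: is_min_poly_def intro: dvd_imp_degree_le)
  have size: "\<exists>d\<ge>1. card (carrier (poly_quotient_algebra (orbit_min_poly \<O>))) = CARD('k) ^ d"
    if "\<O> \<in> Orb" for \<O>
  proof (intro exI conjI)
    \<comment> \<open>The exponent \<open>d\<close> is the degree of the minimal polynomial,
      positive because an irreducible polynomial is no unit.\<close>
    have "orbit_min_poly \<O> \<noteq> 0" "\<not> orbit_min_poly \<O> dvd 1"
      using orbit_min_poly_irreducible[OF that] by (auto simp: Factorial_Ring.irreducible_def)
    then show "card (carrier (poly_quotient_algebra (orbit_min_poly \<O>))) =
        CARD('k) ^ Polynomial.degree (orbit_min_poly \<O>)"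
      and "Polynomial.degree (orbit_min_poly \<O>) \<ge> 1"
      using poly_presentation.card_carrier[OF quot card_ge_0_finite[OF CARD_pos]]
        is_unit_iff_degree[of "orbit_min_poly \<O>"] by auto
  qed
  show ?thesis
    unfolding Let_def assms(4)[symmetric]
    by (intro conjI ballI fam.semisimple[OF cayley.poly_presentation_axioms] bij_frob
        orbit_min_poly_spec(2) min squarefree_prod_orbit_min_poly inj_on_orbit_min_poly
        orbit_min_poly_monic orbit_min_poly_irreducible size
        cayley.isomorphic[OF fam.poly_presentation_product[OF quot]]
        poly_presentation.field[OF quot] poly_presentation.algebra[OF quot])
qed

end
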